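(* Let $w[1:n]$ be a string over a totally ordered alphabet and let $g_{rl}$ be the size of the smallest RLSLP generating $w$. Then it is possible to construct a data structure (index) of size $\mathcal{O}(g_{rl})$ that, given $1\le i\le j\le n$, answers the range minimum query on $w[i:j]$ — i.e., returns the position of the leftmost occurrence of the minimum symbol of $w[i:j]$ — in $\mathcal{O}(\log n)$ time.
   Context: A run-length straight-line program (RLSLP) is a context-free grammar in which each variable has exactly one rule, variables can be ordered so that each rule's right-hand side mentions only terminals and strictly smaller variables, and the rules have one of the forms $A\rightarrow a$ ($a$ a terminal), $A\rightarrow A_1\cdots A_k$ ($k>1$ variables), or $A\rightarrow B^t$ with integer $t>2$ (deriving $t$ concatenated copies of the string derived by $B$); it generates the unique string derived by its start variable. Its size is the sum of the lengths of the right-hand sides, with a rule $A\rightarrow B^t$ counting as size 2. Space is measured in machine words of $\Theta(\log n)$ bits. *)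

theory Defs
  imports Complex_Main "HOL-Library.Landau_Symbols"
begin

text \<open>Run-length straight-line programs, with natural numbers as names of the variables.\<close>

datatype 'a rhs =
    Term 'a
  | Cat "nat list"
  | Run nat nat  \<comment> \<open>\<open>Run B t\<close> stands for the right-hand side \<open>B\<^sup>t\<close>\<close>

fun rhs_vars :: "'a rhs \<Rightarrow> nat set" where
  "rhs_vars (Term a) = {}"
| "rhs_vars (Cat Bs) = set Bs"
| "rhs_vars (Run B t) = {B}"

fun rhs_ok :: "'a rhs \<Rightarrow> bool" where
  "rhs_ok (Term a) \<longleftrightarrow> True"
| "rhs_ok (Cat Bs) \<longleftrightarrow> length Bs > 1"
| "rhs_ok (Run B t) \<longleftrightarrow> t > 2"

fun rhs_size :: "'a rhs \<Rightarrow> nat" where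
  "rhs_size (Term a) = 1"
| "rhs_size (Cat Bs) = length Bs"
| "rhs_size (Run B t) = 2"

text \<open>The domain of the partial map \<open>rules\<close> is the set of variables of the grammar.\<close>

record 'a grammar =
  rules :: "nat \<rightharpoonup> 'a rhs"
  start :: nat

text \<open>The last condition of \<open>rlslp\<close> is the existence of an ordering of the variables in which
  every right-hand side mentions only smaller variables; \<open>rank\<close> is the position in that ordering.\<close>

definition rlslp :: "'a grammar \<Rightarrow> bool" where
  "rlslp G \<longleftrightarrow>
     finite (dom (rules G)) \<and>
     start G \<in> dom (rules G) \<and>
     (\<forall>A r. rules G A = Some r \<longrightarrow> rhs_ok r \<and> rhs_vars r \<subseteq> dom (rules G)) \<and>
     (\<exists>rank :: nat \<Rightarrow> nat. inj_on rank (dom (rules G)) \<and>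
        (\<forall>A r B. rules G A = Some r \<longrightarrow> B \<in> rhs_vars r \<longrightarrow> rank B < rank A))"

inductive derives :: "'a grammar \<Rightarrow> nat \<Rightarrow> 'a list \<Rightarrow> bool" for G where
  Term: "rules G A = Some (Term a) \<Longrightarrow> derives G A [a]"
| Cat: "rules G A = Some (Cat Bs) \<Longrightarrow> list_all2 (derives G) Bs us \<Longrightarrow> derives G A (concat us)"
| Run: "rules G A = Some (Run B t) \<Longrightarrow> derives G B u \<Longrightarrow> derives G A (concat (replicate t u))"

definition generates :: "'a grammar \<Rightarrow> 'a list \<Rightarrow> bool" where
  "generates G w \<longleftrightarrow> derives G (start G) w"

definition grammar_size :: "'a grammar \<Rightarrow> nat" where
  "grammar_size G = (\<Sum>A \<in> dom (rules G). rhs_size (the (rules G A)))"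

definition g_rl :: "'a list \<Rightarrow> nat" where
  "g_rl w = (LEAST s. \<exists>G. rlslp G \<and> generates G w \<and> grammar_size G = s)"

text \<open>The minimum defining \<open>g_rl\<close> ranges over a nonempty set whenever \<open>w\<close> is nonempty.\<close>

lemma rlslp_exists:
  assumes "w \<noteq> []"
  shows "\<exists>G. rlslp G \<and> generates G w"
proof (cases "length w = 1")
  case True
  then obtain a where w: "w = [a]" by (auto simp: length_Suc_conv)
  let ?G = "\<lparr>rules = [0 \<mapsto> Term a], start = 0\<rparr>"
  have "rlslp ?G" by (auto simp: rlslp_def intro: exI[of _ id])
  moreover have "generates ?G w" unfolding generates_def w by (rule derives.Term) simp
  ultimately show ?thesis by blast
next
  case False
  define n where "n = length w"
  have n: "n > 1" using False assms by (cases w) (auto simp: n_def)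
  define R where "R = (\<lambda>v. if v < n then Some (Term (w ! v))
                          else if v = n then Some (Cat [0..<n]) else None)"
  let ?G = "\<lparr>rules = R, start = n\<rparr>"
  have d: "dom R = {..n}" by (auto simp: R_def split: if_splits)
  have "rlslp ?G" unfolding rlslp_def
    using n by (auto simp: d intro!: exI[of _ id]) (auto simp: R_def split: if_splits)
  moreover have "generates ?G w"
  proof -
    have "list_all2 (derives ?G) [0..<n] (map (\<lambda>a. [a]) w)"
      by (auto simp: list_all2_conv_all_nth n_def[symmetric] intro!: derives.Term)
         (auto simp: R_def)
    then have "derives ?G n (concat (map (\<lambda>a. [a]) w))"
      by (rule derives.Cat[rotated]) (auto simp: R_def)
    then show ?thesis by (simp add: generates_def)
  qed
  ultimately show ?thesis by blast
qed

text \<open>Positions are 1-based, while list indexing is 0-based.\<close>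

definition rmq :: "'a::linorder list \<Rightarrow> nat \<Rightarrow> nat \<Rightarrow> nat" where
  "rmq w i j =
     (LEAST p. i \<le> p \<and> p \<le> j \<and> w ! (p - 1) = Min ((\<lambda>q. w ! (q - 1)) ` {i..j}))"

text \<open>A unit-cost word RAM, given as a structured programming language. All values are unsigned
  machine words of \<open>b\<close> bits. A program has a read-only index (a list of words), registers, and a
  working memory addressed by words. It cannot inspect the represented string in any other way,
  and a fixed program accesses only finitely many registers. Since every node of an
  expression costs one step, so does every arithmetic operation and every memory access.\<close>

datatype binop = Add | Sub | Mul | Div | Mod | Less | Equal | And | Or | Xor | Shl | Shr

fun binop_val :: "binop \<Rightarrow> nat \<Rightarrow> nat \<Rightarrow> nat" where
  "binop_val Add x y = x + y"
| "binop_val Sub x y = x - y"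
| "binop_val Mul x y = x * y"
| "binop_val Div x y = x div y"
| "binop_val Mod x y = x mod y"
| "binop_val Less x y = of_bool (x < y)"
| "binop_val Equal x y = of_bool (x = y)"
| "binop_val And x y = Bit_Operations.and x y"
| "binop_val Or x y = Bit_Operations.or x y"
| "binop_val Xor x y = Bit_Operations.xor x y"
| "binop_val Shl x y = push_bit y x"
| "binop_val Shr x y = drop_bit y x"

datatype expr =
    Const nat
  | Reg nat
  | Index expr
  | Work expr
  | Op binop expr expr

datatype com =
    Skip
  | SetReg nat expr
  | SetWork expr expr  \<comment> \<open>address, value\<close>
  | Seq com com
  | Cond expr com com
  | While expr com

record mem =
  regs :: "nat \<Rightarrow> nat"
  work :: "nat \<Rightarrow> nat"

text \<open>Results are reduced modulo \<open>2\<^sup>b\<close>, and reading beyond the end of the index yields \<open>0\<close>.\<close>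

fun expr_val :: "nat \<Rightarrow> nat list \<Rightarrow> mem \<Rightarrow> expr \<Rightarrow> nat" where
  "expr_val b D s (Const m) = take_bit b m"
| "expr_val b D s (Reg x) = regs s x"
| "expr_val b D s (Index e) =
     (let a = expr_val b D s e in if a < length D then D ! a else 0)"
| "expr_val b D s (Work e) = work s (expr_val b D s e)"
| "expr_val b D s (Op f e1 e2) =
     take_bit b (binop_val f (expr_val b D s e1) (expr_val b D s e2))"

fun expr_cost :: "expr \<Rightarrow> nat" where
  "expr_cost (Const m) = 1"
| "expr_cost (Reg x) = 1"
| "expr_cost (Index e) = 1 + expr_cost e"
| "expr_cost (Work e) = 1 + expr_cost e"
| "expr_cost (Op f e1 e2) = 1 + expr_cost e1 + expr_cost e2"

text \<open>\<open>exec b D c s t s'\<close>: with word length \<open>b\<close> and index \<open>D\<close>, the program \<open>c\<close> started in \<open>s\<close>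
  terminates in \<open>s'\<close> after \<open>t\<close> steps. Conditions are true iff nonzero.\<close>

inductive exec :: "nat \<Rightarrow> nat list \<Rightarrow> com \<Rightarrow> mem \<Rightarrow> nat \<Rightarrow> mem \<Rightarrow> bool" for b D where
  Skip: "exec b D Skip s 1 s"
| SetReg: "exec b D (SetReg x e) s (1 + expr_cost e) (s\<lparr>regs := (regs s)(x := expr_val b D s e)\<rparr>)"
| SetWork: "exec b D (SetWork e1 e2) s (1 + expr_cost e1 + expr_cost e2)
     (s\<lparr>work := (work s)(expr_val b D s e1 := expr_val b D s e2)\<rparr>)"
| Seq: "exec b D c1 s t1 s' \<Longrightarrow> exec b D c2 s' t2 s'' \<Longrightarrow> exec b D (Seq c1 c2) s (t1 + t2) s''"
| CondTrue: "expr_val b D s e \<noteq> 0 \<Longrightarrow> exec b D c1 s t s' \<Longrightarrow>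
     exec b D (Cond e c1 c2) s (1 + expr_cost e + t) s'"
| CondFalse: "expr_val b D s e = 0 \<Longrightarrow> exec b D c2 s t s' \<Longrightarrow>
     exec b D (Cond e c1 c2) s (1 + expr_cost e + t) s'"
| WhileTrue: "expr_val b D s e \<noteq> 0 \<Longrightarrow> exec b D c s t1 s' \<Longrightarrow> exec b D (While e c) s' t2 s'' \<Longrightarrow>
     exec b D (While e c) s (1 + expr_cost e + t1 + t2) s''"
| WhileFalse: "expr_val b D s e = 0 \<Longrightarrow> exec b D (While e c) s (1 + expr_cost e) s"

text \<open>The two arguments of a query are passed in registers 0 and 1, all other words of the
  memory are initially zero, and the result is returned in register 0.\<close>

definition query_mem :: "nat \<Rightarrow> nat \<Rightarrow> mem" where
  "query_mem i j = \<lparr>regs = (\<lambda>_. 0)(0 := i, 1 := j), work = (\<lambda>_. 0)\<rparr>"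

definition answers :: "nat \<Rightarrow> nat list \<Rightarrow> com \<Rightarrow> nat \<Rightarrow> nat \<Rightarrow> nat \<Rightarrow> nat \<Rightarrow> bool" where
  "answers b D P i j t p \<longleftrightarrow> (\<exists>s. exec b D P (query_mem i j) t s \<and> regs s 0 = p)"

end

(* A grammar for w is viewed as a tree with concatenation and run nodes whose distinct subtrees are the
   grammar symbols. It is first balanced, following Ganardi, Jez and Lohrey: call an edge heavy
   if both ends agree in the rounded logarithms of their number of occurrences and of their length.
   Heavy edges form disjoint chains, and a root-to-leaf path has O(log n) light edges. Along a chain, a
   node derives the chain's end flanked by the off-chain siblings below it, so all nodes of the chain
   can be rebuilt from suffixes of two sequences of siblings. These suffixes are shared in one search
   tree that is biased both by the lengths of the siblings and by how often the chain is entered at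
   each node; the route from an entry to a sibling is then logarithmic in two ratios that telescope
   along a root-to-leaf path. Run nodes double the length, hence have only light edges and need no
   special treatment. The result has linearly many distinct subtrees and logarithmic height.

   On a balanced tree, a query splits into a suffix and a prefix query, each following one path;
   in a run only the copies at both ends of the range, or one complete copy, matter. *)

theory Submission
  imports Defs "HOL-Library.Discrete_Functions" "HOL-Real_Asymp.Real_Asymp"
begin

section \<open>Trees with run nodes\<close>

text \<open>The obstacle is sharing. A chain is entered at many of its nodes, and rebuilding the
  suffix of each entry on its own can cost quadratically many nodes. Taking all suffixes from one
  search tree shares nodes, but a suffix then pays for the depth of its first element, whichever
  sibling is sought. Weighting also by \<open>ent\<close>, the occurrences that do not arrive
  through the heavy parent, bounds this price by the logarithm of the chain's occurrences over
  \<open>ent\<close>. A light edge from \<open>p\<close> to \<open>c\<close> gives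
  \<open>ent c\<close> at least \<open>oc p\<close>, so the prices telescope; their sum is
  logarithmic because the occurrences of a node are disjoint factors of the string. A node with
  \<open>ent\<close> zero is reached only along its chain, so no height is claimed for it. The
  rounding and the joins of each chain leave an additive constant, which the drop of
  \<open>nu\<close> on the next light edge absorbs.\<close>

datatype 'a tr = Chr 'a | Bin "'a tr" "'a tr" | Rep "'a tr" nat

primrec yield :: "'a tr \<Rightarrow> 'a list" where
  "yield (Chr a) = [a]"
| "yield (Bin l r) = yield l @ yield r"
| "yield (Rep u k) = concat (replicate k (yield u))"

primrec len :: "'a tr \<Rightarrow> nat" where
  "len (Chr a) = 1"
| "len (Bin l r) = len l + len r"
| "len (Rep u k) = k * len u"

primrec height :: "'a tr \<Rightarrow> nat" where
  "height (Chr a) = 0"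
| "height (Bin l r) = Suc (max (height l) (height r))"
| "height (Rep u k) = Suc (height u)"

text \<open>Equal subtrees are one element, so the cardinality is the size of the tree when stored
  with sharing.\<close>

primrec subs :: "'a tr \<Rightarrow> 'a tr set" where
  "subs (Chr a) = {Chr a}"
| "subs (Bin l r) = insert (Bin l r) (subs l \<union> subs r)"
| "subs (Rep u k) = insert (Rep u k) (subs u)"

primrec wft :: "'a tr \<Rightarrow> bool" where
  "wft (Chr a) \<longleftrightarrow> True"
| "wft (Bin l r) \<longleftrightarrow> wft l \<and> wft r"
| "wft (Rep u k) \<longleftrightarrow> k \<ge> 2 \<and> wft u"

primrec child :: "'a tr \<Rightarrow> 'a tr \<Rightarrow> bool" where
  "child (Chr a) c \<longleftrightarrow> False"
| "child (Bin l r) c \<longleftrightarrow> c = l \<or> c = r"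
| "child (Rep u k) c \<longleftrightarrow> c = u"

text \<open>Occurrences are counted in the unfolded tree, where every copy of a run counts.\<close>

primrec occ :: "'a tr \<Rightarrow> 'a tr \<Rightarrow> nat" where
  "occ s (Chr a) = of_bool (s = Chr a)"
| "occ s (Bin l r) = of_bool (s = Bin l r) + occ s l + occ s r"
| "occ s (Rep u k) = of_bool (s = Rep u k) + k * occ s u"

lemma length_yield: "length (yield t) = len t"
  by (induction t) (auto simp: length_concat sum_list_replicate)

lemma len_pos: "wft t \<Longrightarrow> len t > 0"
  by (induction t) auto

lemma finite_subs: "finite (subs t)"
  by (induction t) auto

lemma subs_self: "t \<in> subs t"
  by (cases t) auto

lemma subs_trans: "s \<in> subs t \<Longrightarrow> subs s \<subseteq> subs t"
  by (induction t) auto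

lemma child_subs: "child p c \<Longrightarrow> c \<in> subs p"
  by (cases p) (auto simp: subs_self)

lemma size_subs: "s \<in> subs t \<Longrightarrow> size s \<le> size t"
  by (induction t) auto

lemma size_child: "child p c \<Longrightarrow> size c < size p"
  by (cases p) auto

lemma wft_subs: "s \<in> subs t \<Longrightarrow> wft t \<Longrightarrow> wft s"
  by (induction t) auto

lemma len_child: "child p c \<Longrightarrow> wft p \<Longrightarrow> len c \<le> len p"
  by (cases p) auto

lemma height_le_len: "wft t \<Longrightarrow> height t \<le> len t"
proof (induction t)
  case (Bin l r)
  then show ?case using len_pos[of l] len_pos[of r] by auto
next
  case (Rep u k)
  then have "height u \<le> len u" "0 < len u" "k \<ge> 2" by (auto simp: len_pos)
  moreover from this have "2 * len u \<le> k * len u" by (intro mult_right_mono) auto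
  ultimately show ?case unfolding height.simps len.simps by linarith
qed auto

lemma len_subs: "s \<in> subs t \<Longrightarrow> wft t \<Longrightarrow> len s \<le> len t"
proof (induction t)
  case (Rep u k)
  then have "len u \<le> k * len u" by auto
  moreover have "s = Rep u k \<or> len s \<le> len u" using Rep by auto
  ultimately show ?case by (metis le_trans len.simps(3) order_refl)
qed auto

text \<open>A crude bound that makes addresses of subtrees fit into a machine word.\<close>

lemma card_subs_le: "wft t \<Longrightarrow> card (subs t) < 2 * len t"
proof (induction t)
  case (Bin l r)
  have "card (subs (Bin l r)) \<le> Suc (card (subs l \<union> subs r))"
    by (simp add: card_insert_le_m1 finite_subs card_insert_if)
  also have "card (subs l \<union> subs r) \<le> card (subs l) + card (subs r)" by (rule card_Un_le)
  finally show ?case using Bin by auto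
next
  case (Rep u k)
  then have "card (subs u) < 2 * len u" "k \<ge> 2" "len u > 0" by (auto simp: len_pos)
  moreover from this have "2 * len u \<le> k * len u" by (intro mult_right_mono) auto
  moreover have "card (subs (Rep u k)) \<le> Suc (card (subs u))"
    by (simp add: finite_subs card_insert_if)
  ultimately show ?case unfolding len.simps by linarith
qed auto

section \<open>Counting occurrences of shared subtrees\<close>

lemma occ_eq_0: "s \<notin> subs t \<Longrightarrow> occ s t = 0"
  by (induction t) (auto simp: subs_self)

lemma occ_pos: "s \<in> subs t \<Longrightarrow> wft t \<Longrightarrow> occ s t > 0"
  by (induction t) auto

lemma occ_larger: "size t < size s \<Longrightarrow> occ s t = 0"
  by (rule occ_eq_0) (use size_subs in fastforce)

lemma occ_self: "occ t t = 1"
  by (cases t) (auto simp: occ_larger)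

lemma occ_child: "child p c \<Longrightarrow> wft t \<Longrightarrow> occ p t \<le> occ c t"
proof (induction t)
  case (Chr a)
  then show ?case by (auto split: if_splits)
next
  case (Bin l r)
  show ?case
  proof (cases "p = Bin l r")
    case True
    with Bin.prems show ?thesis by (auto simp: occ_self occ_larger)
  qed (use Bin in auto)
next
  case (Rep u k)
  show ?case
  proof (cases "p = Rep u k")
    case True
    with Rep.prems show ?thesis by (auto simp: occ_self occ_larger)
  qed (use Rep in \<open>auto intro: le_SucI\<close>)
qed

text \<open>Every occurrence of a parent has an occurrence of \<open>c\<close> directly below it,
  and different parents have different ones.\<close>

lemma occ_two_parents:
  assumes "child p c" "child q c" "p \<noteq> q" "wft t"
  shows "occ p t + occ q t \<le> occ c t"
  using assms(4)
proof (induction t)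
  case (Chr a)
  then show ?case using assms by (auto split: if_splits)
next
  case (Bin l r)
  have IH: "occ p l + occ q l \<le> occ c l" "occ p r + occ q r \<le> occ c r" using Bin by auto
  have c: "size c < size p" "size c < size q" using assms size_child by auto
  \<comment> \<open>Here \<open>p'\<close> is the whole tree and \<open>c\<close> one of its
    children. Within that child \<open>c\<close> occurs once and the larger \<open>q'\<close> not at
    all, so this occurrence is free to be charged to \<open>p'\<close>.\<close>
  have *: "occ p' (Bin l r) + occ q' (Bin l r) \<le> occ c (Bin l r)"
    if p': "p' = Bin l r" "p' \<noteq> q'" "child p' c" "child q' c" "size c < size q'" for p' q'
  proof -
    have "occ q' l \<le> occ c l" "occ q' r \<le> occ c r"
      using p' occ_child Bin.prems by auto
    moreover have "occ p' l = 0" "occ p' r = 0" using p' by (auto simp: occ_larger)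
    moreover have "c = l \<and> occ c l = 1 \<and> occ q' l = 0 \<or> c = r \<and> occ c r = 1 \<and> occ q' r = 0"
      using p' by (auto simp: occ_self occ_larger)
    ultimately show ?thesis using p' by auto
  qed
  show ?case
  proof (cases "p = Bin l r \<or> q = Bin l r")
    case True
    then show ?thesis using *[of p q] *[of q p] assms c by (auto simp: add.commute)
  qed (use IH in auto)
next
  case (Rep u k)
  have IH: "occ p u + occ q u \<le> occ c u" using Rep by auto
  have c: "size c < size p" "size c < size q" using assms size_child by auto
  have *: "occ p' (Rep u k) + occ q' (Rep u k) \<le> occ c (Rep u k)"
    if p': "p' = Rep u k" "p' \<noteq> q'" "child p' c" "child q' c" "size c < size q'" for p' q'
    using p' Rep.prems by (auto simp: occ_self occ_larger)
  show ?case
  proof (cases "p = Rep u k \<or> q = Rep u k")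
    case True
    then show ?thesis using *[of p q] *[of q p] assms c by (auto simp: add.commute)
  next
    case False
    have "k * (occ p u + occ q u) \<le> k * occ c u" using IH by simp
    with False show ?thesis by (auto simp: algebra_simps)
  qed
qed

text \<open>Occurrences of the same subtree are never nested, so they derive disjoint
  factors.\<close>

lemma occ_len: "wft t \<Longrightarrow> occ s t * len s \<le> len t"
proof (induction t)
  case (Bin l r)
  then show ?case by (cases "s = Bin l r") (auto simp: occ_larger algebra_simps intro: add_mono)
next
  case (Rep u k)
  show ?case
  proof (cases "s = Rep u k")
    case False
    have "k * (occ s u * len s) \<le> k * len u" using Rep by (intro mult_left_mono) auto
    with False show ?thesis by (simp add: algebra_simps)
  qed (simp add: occ_larger)
qed auto

section \<open>Heavy chains\<close>

locale tree_dag =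
  fixes T :: "'a tr"
  assumes wf: "wft T"
begin

abbreviation oc :: "'a tr \<Rightarrow> nat" where "oc s \<equiv> occ s T"

definition heavy :: "'a tr \<Rightarrow> 'a tr \<Rightarrow> bool" where
  "heavy s c \<longleftrightarrow> s \<in> subs T \<and> child s c \<and>
     floor_log (oc s) = floor_log (oc c) \<and> floor_log (len s) = floor_log (len c)"

definition light :: "'a tr \<Rightarrow> 'a tr \<Rightarrow> bool" where
  "light s c \<longleftrightarrow> s \<in> subs T \<and> child s c \<and> \<not> heavy s c"

lemma floor_log_double: "x > 0 \<Longrightarrow> 2 * x \<le> y \<Longrightarrow> floor_log x < floor_log y"
  by (metis floor_log_le_iff floor_log_twice less_eq_Suc_le neq0_conv)

lemma wf_subs: "s \<in> subs T \<Longrightarrow> wft s"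
  using wf wft_subs by blast

lemma child_in: "s \<in> subs T \<Longrightarrow> child s c \<Longrightarrow> c \<in> subs T"
  using child_subs subs_trans by blast

lemma heavy_in: "heavy s c \<Longrightarrow> s \<in> subs T" "heavy s c \<Longrightarrow> c \<in> subs T"
  using child_in by (auto simp: heavy_def)

lemma light_in: "light s c \<Longrightarrow> s \<in> subs T" "light s c \<Longrightarrow> c \<in> subs T"
  using child_in by (auto simp: light_def)

lemma heavy_size: "heavy s c \<Longrightarrow> size c < size s"
  by (simp add: heavy_def size_child)

text \<open>The shorter of two children has at most half of the length, hence a smaller rounded
  logarithm, so at most one child is heavy. In a run each copy has at most half of the
  length.\<close>

lemma heavy_Bin:
  assumes "heavy s c"
  obtains l r where "s = Bin l r"
    "c = l \<and> heavy s l \<and> \<not> heavy s r \<or> c = r \<and> heavy s r \<and> \<not> heavy s l"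
proof (cases s)
  case (Chr a)
  with assms show ?thesis by (simp add: heavy_def)
next
  case (Bin l r)
  have "\<not> (heavy s l \<and> heavy s r)"
  proof
    assume h: "heavy s l \<and> heavy s r"
    have "wft s" using assms wf_subs heavy_in by blast
    then have "len l > 0" "len r > 0" using Bin len_pos by auto
    moreover have "2 * len l \<le> len s \<or> 2 * len r \<le> len s" using Bin by auto
    ultimately have "floor_log (len l) < floor_log (len s) \<or> floor_log (len r) < floor_log (len s)"
      using floor_log_double by blast
    with h show False by (auto simp: heavy_def)
  qed
  moreover have "c = l \<or> c = r" using Bin assms by (auto simp: heavy_def)
  ultimately show ?thesis using that[OF Bin] assms by auto
next
  case (Rep u k)
  have "wft s" using assms wf_subs heavy_in by blast
  then have "len u > 0" "2 * len u \<le> len s" using Rep len_pos by auto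
  then have "floor_log (len u) < floor_log (len s)" by (rule floor_log_double)
  with assms Rep show ?thesis by (auto simp: heavy_def)
qed

lemma heavy_child_unique: "heavy s c \<Longrightarrow> heavy s c' \<Longrightarrow> c = c'"
  by (metis heavy_Bin tr.inject(2))

text \<open>Two parents split the occurrences of \<open>c\<close>, so the rarer one has at most half
  of them and a smaller rounded logarithm.\<close>

lemma heavy_parent_unique:
  assumes "heavy s c" "heavy s' c" shows "s = s'"
proof (rule ccontr)
  assume "s \<noteq> s'"
  then have "oc s + oc s' \<le> oc c" using assms wf by (auto simp: heavy_def intro: occ_two_parents)
  moreover have "oc s > 0" "oc s' > 0" using assms heavy_in occ_pos wf by blast+
  ultimately have "floor_log (oc s) < floor_log (oc c) \<or> floor_log (oc s') < floor_log (oc c)"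
    using floor_log_double[of "oc s" "oc c"] floor_log_double[of "oc s'" "oc c"] by linarith
  with assms show False by (auto simp: heavy_def)
qed

text \<open>The occurrences of \<open>s\<close> that are not reached through its heavy parent.\<close>

definition ent :: "'a tr \<Rightarrow> nat" where
  "ent s = oc s - (\<Sum>p | heavy p s. oc p)"

lemma ent_le: "ent s \<le> oc s"
  by (simp add: ent_def)

lemma ent_heavy: assumes "heavy p c" shows "ent c + oc p = oc c"
proof -
  have "{q. heavy q c} = {p}" using assms heavy_parent_unique by auto
  moreover have "oc p \<le> oc c" using assms wf by (auto simp: heavy_def occ_child)
  ultimately show ?thesis by (simp add: ent_def)
qed

lemma ent_no_heavy: "(\<And>p. \<not> heavy p c) \<Longrightarrow> ent c = oc c"
  by (simp add: ent_def)

text \<open>If \<open>c\<close> also has a heavy parent, it differs from \<open>p\<close>, and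
  \<open>ent\<close> subtracts only the occurrences below that other parent.\<close>

lemma ent_light: assumes "light p c" shows "oc p \<le> ent c"
proof (cases "\<exists>q. heavy q c")
  case True
  then obtain q where q: "heavy q c" by blast
  then have "oc p + oc q \<le> oc c"
    using assms wf by (intro occ_two_parents) (auto simp: heavy_def light_def)
  with ent_heavy[OF q] show ?thesis by linarith
next
  case False
  with assms wf show ?thesis by (simp add: ent_no_heavy light_def occ_child)
qed

lemma ent_root: "ent T = 1"
proof -
  have "\<not> heavy p T" for p
    using heavy_size[of p T] heavy_in[of p T] size_subs[of p T] by auto
  then show ?thesis by (simp add: ent_no_heavy occ_self)
qed

text \<open>A potential that is constant on chains and drops on light edges. The subtraction does
  not truncate, since a node of \<open>T\<close> occurs at most \<open>len T\<close> times.\<close>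

definition nu :: "'a tr \<Rightarrow> nat" where
  "nu s = floor_log (len T) - floor_log (oc s) + floor_log (len s)"

lemma oc_le: "s \<in> subs T \<Longrightarrow> oc s \<le> len T"
  using occ_len[OF wf, of s] len_pos[of s] wf_subs[of s]
  by (metis One_nat_def Suc_leI le_trans mult.right_neutral mult_le_mono2)

lemma nu_light: assumes "light s c" shows "nu c < nu s"
proof -
  have "oc s \<le> oc c" using assms wf by (simp add: light_def occ_child)
  moreover have "len c \<le> len s" using assms wf_subs by (auto simp: light_def len_child)
  moreover have "oc c \<le> len T" using assms by (simp add: oc_le light_in)
  ultimately have "floor_log (oc s) \<le> floor_log (oc c)" "floor_log (len c) \<le> floor_log (len s)"
    "floor_log (oc c) \<le> floor_log (len T)"
    by (simp_all add: floor_log_le_iff)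
  moreover have "floor_log (oc s) \<noteq> floor_log (oc c) \<or> floor_log (len s) \<noteq> floor_log (len c)"
    using assms by (auto simp: light_def heavy_def)
  ultimately show ?thesis unfolding nu_def by linarith
qed

primrec chain :: "'a tr \<Rightarrow> 'a tr list" where
  "chain (Chr a) = [Chr a]"
| "chain (Bin l r) = Bin l r # (if heavy (Bin l r) l then chain l
     else if heavy (Bin l r) r then chain r else [])"
| "chain (Rep u k) = [Rep u k]"

primrec heavy_left :: "'a tr \<Rightarrow> bool" where
  "heavy_left (Chr a) \<longleftrightarrow> False"
| "heavy_left (Bin l r) \<longleftrightarrow> heavy (Bin l r) l"
| "heavy_left (Rep u k) \<longleftrightarrow> False"

primrec off :: "'a tr \<Rightarrow> 'a tr" where
  "off (Chr a) = Chr a"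
| "off (Bin l r) = (if heavy (Bin l r) l then r else l)"
| "off (Rep u k) = u"

lemma chain_heavy: "heavy s c \<Longrightarrow> chain s = s # chain c"
  by (erule heavy_Bin) auto

lemma chain_no_heavy: "(\<And>c. \<not> heavy s c) \<Longrightarrow> chain s = [s]"
  by (cases s) auto

lemma off_light: "heavy s c \<Longrightarrow> light s (off s)"
  by (frule heavy_in, erule heavy_Bin) (auto simp: light_def)

lemma yield_off:
  "heavy s c \<Longrightarrow> yield s = (if heavy_left s then [] else yield (off s)) @ yield c @
     (if heavy_left s then yield (off s) else [])"
  by (erule heavy_Bin) auto

lemma len_off: "heavy s c \<Longrightarrow> len s = len c + len (off s)"
  by (erule heavy_Bin) auto

lemma chain_induct [case_names heavy stop]:
  assumes "\<And>s c. heavy s c \<Longrightarrow> P c \<Longrightarrow> P s" "\<And>s. (\<And>c. \<not> heavy s c) \<Longrightarrow> P s"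
  shows "P s"
proof (induction s rule: measure_induct_rule[of size])
  case (less s)
  then show ?case using assms heavy_size by blast
qed

lemma chain_Cons: "\<exists>xs. chain s = s # xs"
  by (cases s) auto

lemma chain_not_Nil [simp]: "chain s \<noteq> []"
  using chain_Cons[of s] by auto

lemma set_chain: "x \<in> set (chain s) \<longleftrightarrow> heavy\<^sup>*\<^sup>* s x"
proof (induction s rule: chain_induct)
  case (heavy s c)
  have "heavy\<^sup>*\<^sup>* s x \<longleftrightarrow> x = s \<or> heavy\<^sup>*\<^sup>* c x"
    using heavy(1) by (metis converse_rtranclpE converse_rtranclp_into_rtranclp heavy_child_unique
        rtranclp.rtrancl_refl)
  with heavy show ?case by (simp add: chain_heavy)
next
  case (stop s)
  then show ?case by (auto simp: chain_no_heavy elim: converse_rtranclpE)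
qed

lemma chain_size: "x \<in> set (chain s) \<Longrightarrow> size x \<le> size s"
  by (induction s rule: chain_induct) (fastforce simp: chain_heavy chain_no_heavy dest: heavy_size)+

lemma distinct_chain: "distinct (chain s)"
proof (induction s rule: chain_induct)
  case (heavy s c)
  then have "s \<notin> set (chain c)" using chain_size heavy_size by fastforce
  with heavy show ?case by (simp add: chain_heavy)
qed (simp add: chain_no_heavy)

lemma chain_in: "x \<in> set (chain s) \<Longrightarrow> s \<in> subs T \<Longrightarrow> x \<in> subs T"
  by (induction s rule: chain_induct) (auto simp: chain_heavy chain_no_heavy heavy_in)

lemma chain_ranks:
  "x \<in> set (chain s) \<Longrightarrow> floor_log (oc x) = floor_log (oc s)"
  "x \<in> set (chain s) \<Longrightarrow> floor_log (len x) = floor_log (len s)"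
  by (induction s rule: chain_induct) (auto simp: chain_heavy chain_no_heavy heavy_def)

lemma chain_nu: "x \<in> set (chain s) \<Longrightarrow> nu x = nu s"
  by (simp add: nu_def chain_ranks)

lemma butlast_chain: "x \<in> set (butlast (chain s)) \<Longrightarrow> \<exists>c. heavy x c"
  by (induction s rule: chain_induct) (auto simp: chain_heavy chain_no_heavy split: if_splits)

lemma last_chain: "\<not> heavy (last (chain s)) c"
  by (induction s rule: chain_induct) (auto simp: chain_heavy chain_no_heavy)

text \<open>Along a heavy edge \<open>ent c + oc p = oc c\<close>, so the sum telescopes. At a head
  \<open>ent s = oc s\<close>, and all entries together are at most the occurrences of the chain's
  end.\<close>

lemma sum_ent_chain: "(\<Sum>x\<leftarrow>chain s. ent x) + oc s \<le> oc (last (chain s)) + ent s"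
proof (induction s rule: chain_induct)
  case (heavy s c)
  then show ?case using ent_heavy[OF heavy(1)] by (simp add: chain_heavy)
qed (simp add: chain_no_heavy)

lemma sum_len_chain: "(\<Sum>x\<leftarrow>butlast (chain s). len (off x)) + len (last (chain s)) = len s"
proof (induction s rule: chain_induct)
  case (heavy s c)
  then show ?case using len_off[OF heavy(1)] by (simp add: chain_heavy)
qed (simp add: chain_no_heavy)

definition head :: "'a tr \<Rightarrow> bool" where
  "head h \<longleftrightarrow> h \<in> subs T \<and> (\<forall>p. \<not> heavy p h)"

text \<open>Take the largest node whose chain runs through \<open>s\<close>: a heavy parent of it
  would be larger still.\<close>

lemma head_exists:
  assumes "s \<in> subs T"
  shows "\<exists>h. head h \<and> s \<in> set (chain h)"
proof -
  let ?S = "{h \<in> subs T. s \<in> set (chain h)}"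
  have fin: "finite (size ` ?S)" using finite_subs[of T] by simp
  have "s \<in> ?S" using assms by (simp add: set_chain)
  then have "Max (size ` ?S) \<in> size ` ?S" using fin by (intro Max_in) auto
  then obtain h where h: "h \<in> ?S" "size h = Max (size ` ?S)" by force
  have max: "size h' \<le> size h" if "h' \<in> ?S" for h'
    unfolding h(2) using fin that by (intro Max_ge) auto
  have "\<not> heavy p h" for p
  proof
    assume p: "heavy p h"
    then have "p \<in> ?S" using h(1) by (auto simp: set_chain heavy_in intro: converse_rtranclp_into_rtranclp)
    with max[of p] heavy_size[OF p] show False by linarith
  qed
  with h(1) show ?thesis by (auto simp: head_def)
qed

text \<open>Walking upwards from \<open>s\<close> is deterministic, because heavy parents are
  unique.\<close>

lemma heavy_rtranclp_linear:
  "heavy\<^sup>*\<^sup>* h s \<Longrightarrow> heavy\<^sup>*\<^sup>* h' s \<Longrightarrow> heavy\<^sup>*\<^sup>* h h' \<or> heavy\<^sup>*\<^sup>* h' h"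
proof (induction rule: rtranclp_induct)
  case (step y z)
  from step.prems show ?case
  proof (cases rule: rtranclp.cases)
    case rtrancl_refl
    with step show ?thesis by auto
  next
    case (rtrancl_into_rtrancl b)
    with step heavy_parent_unique show ?thesis by metis
  qed
qed auto

lemma head_unique:
  assumes "head h" "head h'" "s \<in> set (chain h)" "s \<in> set (chain h')"
  shows "h = h'"
proof -
  have "heavy\<^sup>*\<^sup>* h h' \<or> heavy\<^sup>*\<^sup>* h' h"
    using assms heavy_rtranclp_linear by (simp add: set_chain)
  then show ?thesis using assms by (auto simp: head_def elim: rtranclp.cases)
qed

end

section \<open>Shared suffixes of a weighted sequence\<close>

text \<open>The flag \<open>d\<close> is \<open>True\<close> for sequences of left siblings. Right siblings are met in reverse order
  and use \<open>False\<close>. \<open>None\<close> stands for the empty string, which no tree derives.\<close>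

fun cat :: "bool \<Rightarrow> 'a tr option \<Rightarrow> 'a tr option \<Rightarrow> 'a tr option" where
  "cat d None y = y"
| "cat d x None = x"
| "cat d (Some x) (Some y) = Some (if d then Bin x y else Bin y x)"

definition app :: "bool \<Rightarrow> 'a list \<Rightarrow> 'a list \<Rightarrow> 'a list" where
  "app d xs ys = (if d then xs @ ys else ys @ xs)"

definition yield_opt :: "'a tr option \<Rightarrow> 'a list" where
  "yield_opt x = (case x of None \<Rightarrow> [] | Some t \<Rightarrow> yield t)"

definition subs_opt :: "'a tr option \<Rightarrow> 'a tr set" where
  "subs_opt x = (case x of None \<Rightarrow> {} | Some t \<Rightarrow> subs t)"

definition wf_height_le :: "'a tr option \<Rightarrow> real \<Rightarrow> bool" where
  "wf_height_le x r \<longleftrightarrow> (\<forall>t. x = Some t \<longrightarrow> wft t \<and> real (height t) \<le> r)"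

lemma yield_opt_simps [simp]: "yield_opt None = []" "yield_opt (Some t) = yield t"
  by (auto simp: yield_opt_def)

lemma subs_opt_simps [simp]: "subs_opt None = {}" "subs_opt (Some t) = subs t"
  by (auto simp: subs_opt_def)

lemma wf_height_le_simps [simp]: "wf_height_le None r" "wf_height_le (Some t) r \<longleftrightarrow> wft t \<and> real (height t) \<le> r"
  by (auto simp: wf_height_le_def)

lemma app_simps [simp]: "app d [] ys = ys" "app d xs [] = xs" "app d (app d xs ys) zs = app d xs (app d ys zs)"
  by (auto simp: app_def)

lemma yield_opt_cat [simp]: "yield_opt (cat d x y) = app d (yield_opt x) (yield_opt y)"
  by (cases "(d, x, y)" rule: cat.cases) (auto simp: app_def)

lemma subs_opt_cat: "subs_opt (cat d x y) \<subseteq> set_option (cat d x y) \<union> subs_opt x \<union> subs_opt y"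
  by (cases "(d, x, y)" rule: cat.cases) auto

lemma wf_height_le_mono: "wf_height_le x r \<Longrightarrow> r \<le> r' \<Longrightarrow> wf_height_le x r'"
  by (auto simp: wf_height_le_def)

lemma wf_height_le_cat: "wf_height_le x r \<Longrightarrow> wf_height_le y r \<Longrightarrow> wf_height_le (cat d x y) (r + 1)"
  by (cases "(d, x, y)" rule: cat.cases) (auto simp: wf_height_le_def)

section \<open>Search trees biased by weight\<close>

datatype 'b bst = Tip | Nd "'b bst" 'b "'b bst"

primrec inord :: "'b bst \<Rightarrow> 'b list" where
  "inord Tip = []"
| "inord (Nd l x r) = inord l @ x # inord r"

definition wt :: "('c \<times> real) list \<Rightarrow> real" where
  "wt xs = sum_list (map snd xs)"

lemma wt_simps [simp]: "wt [] = 0" "wt (x # xs) = snd x + wt xs" "wt (xs @ ys) = wt xs + wt ys"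
  by (auto simp: wt_def)

lemma wt_nonneg: "(\<And>x. x \<in> set xs \<Longrightarrow> snd x > 0) \<Longrightarrow> wt xs \<ge> 0"
  by (auto simp: wt_def intro!: sum_list_nonneg) (metis less_eq_real_def snd_conv)

text \<open>The weight at least halves with every step down, so an element of weight
  \<open>w\<close> in a tree of weight \<open>W\<close> has depth at most
  \<open>log 2 (W / w)\<close>.\<close>

primrec halving :: "('c \<times> real) bst \<Rightarrow> bool" where
  "halving Tip \<longleftrightarrow> True"
| "halving (Nd l x r) \<longleftrightarrow> snd x > 0 \<and> halving l \<and> halving r \<and>
     2 * wt (inord l) \<le> wt (inord (Nd l x r)) \<and> 2 * wt (inord r) \<le> wt (inord (Nd l x r))"

lemma halving_pos: "halving t \<Longrightarrow> x \<in> set (inord t) \<Longrightarrow> snd x > 0"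
  by (induction t) auto

text \<open>Take the first element at which the prefix sums reach half of the total; at most half
  lies before it and at most half after it.\<close>

lemma halving_split:
  assumes "xs \<noteq> []" "\<And>x. x \<in> set xs \<Longrightarrow> snd x > 0"
  shows "\<exists>us x vs. xs = us @ x # vs \<and> 2 * wt us \<le> wt xs \<and> 2 * wt vs \<le> wt xs"
proof -
  let ?P = "\<lambda>k. wt xs \<le> 2 * wt (take (Suc k) xs)"
  have nn: "wt xs \<ge> 0" using assms by (intro wt_nonneg)
  have ex: "?P (length xs - 1)" using assms(1) nn by simp
  define k where "k = (LEAST k. ?P k)"
  have k: "?P k" unfolding k_def by (rule LeastI[of ?P, OF ex])
  have "k \<le> length xs - 1" unfolding k_def by (rule Least_le[of ?P, OF ex])
  then have kl: "k < length xs" using assms(1) by (cases xs) auto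
  have 1: "2 * wt (take k xs) \<le> wt xs"
  proof (cases k)
    case (Suc j)
    then have "\<not> ?P j" unfolding k_def using not_less_Least[of j ?P] by simp
    with Suc show ?thesis by simp
  qed (use nn in simp)
  have eq: "xs = take k xs @ xs ! k # drop (Suc k) xs" using kl by (rule id_take_nth_drop)
  have "wt (take (Suc k) xs) = wt (take k xs) + snd (xs ! k)"
    using kl by (simp add: take_Suc_conv_app_nth)
  moreover have "wt xs = wt (take k xs) + snd (xs ! k) + wt (drop (Suc k) xs)"
    using arg_cong[OF eq, of wt] by simp
  ultimately have "2 * wt (drop (Suc k) xs) \<le> wt xs" using k by simp
  with 1 eq show ?thesis by blast
qed

lemma halving_exists:
  assumes "\<And>x. x \<in> set xs \<Longrightarrow> snd x > 0"
  shows "\<exists>t. inord t = xs \<and> halving t"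
  using assms
proof (induction xs rule: length_induct)
  case (1 xs)
  show ?case
  proof (cases "xs = []")
    case True
    then show ?thesis by (intro exI[of _ Tip]) simp
  next
    case False
    then obtain us x vs where xs: "xs = us @ x # vs" "2 * wt us \<le> wt xs" "2 * wt vs \<le> wt xs"
      using halving_split 1(2) by blast
    obtain l where "inord l = us \<and> halving l" using 1 xs by force
    moreover obtain r where "inord r = vs \<and> halving r" using 1 xs by force
    ultimately show ?thesis using xs 1(2) by (intro exI[of _ "Nd l x r"]) auto
  qed
qed

primrec whole :: "bool \<Rightarrow> ('a tr option \<times> real) bst \<Rightarrow> 'a tr option" where
  "whole d Tip = None"
| "whole d (Nd l x r) = cat d (whole d l) (cat d (fst x) (whole d r))"

text \<open>\<open>tails d t z\<close> lists the trees of all suffixes of \<open>inord t\<close> followed by \<open>z\<close>. A new node is needed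
  only for each node of the search tree, since the part right of it is passed down as the tail \<open>z\<close>.
  The depth of the \<open>j\<close>-th element in the \<open>i\<close>-th suffix is at most the sum of their depths in \<open>t\<close>.\<close>

primrec tails :: "bool \<Rightarrow> ('a tr option \<times> real) bst \<Rightarrow> 'a tr option \<Rightarrow> 'a tr option list" where
  "tails d Tip z = []"
| "tails d (Nd l x r) z =
     (let z' = cat d (cat d (fst x) (whole d r)) z in tails d l z' @ z' # tails d r z)"

text \<open>Three trees for each node of the search tree. The tree \<open>y\<close> is shared by the
  suffix \<open>z'\<close>, which continues it with the tail, and by \<open>whole\<close>, which
  puts the left part before it.\<close>

primrec new_nodes :: "bool \<Rightarrow> ('a tr option \<times> real) bst \<Rightarrow> 'a tr option \<Rightarrow> 'a tr set" where
  "new_nodes d Tip z = {}"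
| "new_nodes d (Nd l x r) z =
     (let y = cat d (fst x) (whole d r); z' = cat d y z in
      new_nodes d l z' \<union> new_nodes d r z \<union>
      set_option y \<union> set_option z' \<union> set_option (whole d (Nd l x r)))"

lemma length_tails: "length (tails d t z) = length (inord t)"
  by (induction t arbitrary: z) (auto simp: Let_def)

lemma finite_new_nodes: "finite (new_nodes d t z)"
  by (induction t arbitrary: z) (auto simp: Let_def)

lemma card_set_option: "card (set_option x) \<le> 1"
  by (cases x) auto

lemma card_new_nodes: "card (new_nodes d t z) \<le> 3 * length (inord t)"
proof (induction t arbitrary: z)
  case (Nd l x r)
  define y where "y = cat d (fst x) (whole d r)"
  define z' where "z' = cat d y z"
  have "new_nodes d (Nd l x r) z = new_nodes d l z' \<union> new_nodes d r z \<union>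
      set_option y \<union> set_option z' \<union> set_option (whole d (Nd l x r))" (is "_ = ?A \<union> ?B \<union> ?C \<union> ?D \<union> ?E")
    unfolding new_nodes.simps Let_def y_def z'_def by (rule refl)
  then have "card (new_nodes d (Nd l x r) z) = card (?A \<union> ?B \<union> ?C \<union> ?D \<union> ?E)"
    by (rule arg_cong)
  also have "\<dots> \<le> card ?A + card ?B + card ?C + card ?D + card ?E"
    using card_Un_le[of "?A \<union> ?B \<union> ?C \<union> ?D" ?E] card_Un_le[of "?A \<union> ?B \<union> ?C" ?D]
      card_Un_le[of "?A \<union> ?B" ?C] card_Un_le[of ?A ?B] by linarith
  also have "\<dots> \<le> 3 * length (inord l) + 3 * length (inord r) + 1 + 1 + 1"
    by (intro add_mono Nd.IH card_set_option)
  finally show ?case by simp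
qed simp

lemma subs_opt_whole: "subs_opt (whole d t) \<subseteq> new_nodes d t z \<union> (\<Union>x\<in>set (inord t). subs_opt (fst x))"
proof (induction t arbitrary: z)
  case (Nd l x r)
  define y where "y = cat d (fst x) (whole d r)"
  have "subs_opt (whole d (Nd l x r)) \<subseteq> set_option (whole d (Nd l x r)) \<union> subs_opt (whole d l) \<union> subs_opt y"
    using subs_opt_cat by (simp add: y_def)
  moreover have "subs_opt y \<subseteq> set_option y \<union> subs_opt (fst x) \<union> subs_opt (whole d r)"
    unfolding y_def by (rule subs_opt_cat)
  moreover have "subs_opt (whole d l) \<subseteq> new_nodes d l (cat d y z) \<union> (\<Union>x\<in>set (inord l). subs_opt (fst x))"
    "subs_opt (whole d r) \<subseteq> new_nodes d r z \<union> (\<Union>x\<in>set (inord r). subs_opt (fst x))"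
    by (rule Nd.IH)+
  ultimately show ?case unfolding new_nodes.simps Let_def y_def[symmetric] by auto
qed simp

lemma subs_opt_tails:
  "s \<in> set (tails d t z) \<Longrightarrow>
     subs_opt s \<subseteq> new_nodes d t z \<union> (\<Union>x\<in>set (inord t). subs_opt (fst x)) \<union> subs_opt z"
proof (induction t arbitrary: z)
  case (Nd l x r)
  define y where "y = cat d (fst x) (whole d r)"
  define z' where "z' = cat d y z"
  let ?R = "new_nodes d (Nd l x r) z \<union> (\<Union>x\<in>set (inord (Nd l x r)). subs_opt (fst x)) \<union> subs_opt z"
  have nn: "new_nodes d (Nd l x r) z = new_nodes d l z' \<union> new_nodes d r z \<union>
      set_option y \<union> set_option z' \<union> set_option (whole d (Nd l x r))"
    unfolding new_nodes.simps Let_def y_def z'_def by (rule refl)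
  have "subs_opt z' \<subseteq> set_option z' \<union> subs_opt y \<union> subs_opt z" unfolding z'_def by (rule subs_opt_cat)
  moreover have "subs_opt y \<subseteq> set_option y \<union> subs_opt (fst x) \<union> subs_opt (whole d r)"
    unfolding y_def by (rule subs_opt_cat)
  moreover note subs_opt_whole[of d r z]
  ultimately have z': "subs_opt z' \<subseteq> ?R" unfolding nn by auto
  have "s \<in> set (tails d l z') \<or> s = z' \<or> s \<in> set (tails d r z)"
    using Nd.prems by (auto simp: Let_def y_def z'_def)
  then show ?case
  proof (elim disjE)
    assume "s \<in> set (tails d l z')"
    then have "subs_opt s \<subseteq> new_nodes d l z' \<union> (\<Union>x\<in>set (inord l). subs_opt (fst x)) \<union> subs_opt z'" by (rule Nd.IH)
    with z' show ?thesis unfolding nn by auto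
  next
    assume "s \<in> set (tails d r z)"
    then have "subs_opt s \<subseteq> new_nodes d r z \<union> (\<Union>x\<in>set (inord r). subs_opt (fst x)) \<union> subs_opt z" by (rule Nd.IH)
    then show ?thesis unfolding nn by auto
  qed (use z' in simp)
qed simp

lemma foldr_app: "foldr (app d) (xs @ ys) z = app d (foldr (app d) xs []) (foldr (app d) ys z)"
  by (induction xs) (auto simp del: foldr_append)

lemma foldr_app_Cons: "foldr (app d) xs z = app d (foldr (app d) xs []) z"
  using foldr_app[of d xs "[]" z] by simp

lemma yield_opt_whole: "yield_opt (whole d t) = foldr (app d) (map (yield_opt \<circ> fst) (inord t)) []"
  by (induction t) (auto simp: foldr_app simp del: foldr_append)

lemma yield_opt_tails:
  "i < length (inord t) \<Longrightarrow>
     yield_opt (tails d t z ! i) = foldr (app d) (drop i (map (yield_opt \<circ> fst) (inord t))) (yield_opt z)"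
proof (induction t arbitrary: z i)
  case (Nd l x r)
  define z' where "z' = cat d (cat d (fst x) (whole d r)) z"
  have z': "yield_opt z' = foldr (app d) (map (yield_opt \<circ> fst) (x # inord r)) (yield_opt z)"
    by (simp add: z'_def yield_opt_whole foldr_app_Cons[of _ _ "yield_opt z"])
  have t: "tails d (Nd l x r) z = tails d l z' @ z' # tails d r z" by (simp add: z'_def Let_def)
  let ?n = "length (inord l)"
  consider "i < ?n" | "i = ?n" | "i > ?n" by linarith
  then show ?case
  proof cases
    case 1
    then show ?thesis using Nd.IH(1)[OF 1, of z'] z'
      by (simp add: t nth_append length_tails comp_def del: tails.simps)
  next
    case 2
    then show ?thesis using z' by (simp add: t nth_append length_tails comp_def del: tails.simps)
  next
    case 3
    then obtain j where j: "i = ?n + Suc j" by (metis less_iff_Suc_add add_Suc_right)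
    then have "j < length (inord r)" using Nd.prems by simp
    then show ?thesis using Nd.IH(2)[of j z] j
      by (simp add: t nth_append length_tails comp_def del: tails.simps)
  qed
qed simp

lemma wt_pos: "xs \<noteq> [] \<Longrightarrow> (\<And>x. x \<in> set xs \<Longrightarrow> snd x > 0) \<Longrightarrow> wt xs > 0"
  using wt_nonneg[of "tl xs"] by (cases xs) (auto intro!: add_pos_nonneg)

lemma log_wt_half:
  assumes "xs \<noteq> []" "\<And>x. x \<in> set xs \<Longrightarrow> snd x > 0" "2 * wt xs \<le> W"
  shows "1 + log 2 (wt xs) \<le> log 2 W"
proof -
  have "wt xs > 0" using assms wt_pos by blast
  moreover from this have "log 2 (2 * wt xs) \<le> log 2 W" using assms(3) by simp
  ultimately show ?thesis by (simp add: log_mult)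
qed

text \<open>Each level joins twice, which adds 2 to the height, and halves the weight, which takes
  at least 2 from twice its logarithm. The elements are granted a height of the same shape, so that
  nested constructions telescope.\<close>

lemma wf_height_le_whole:
  assumes "halving t" "\<And>x. x \<in> set (inord t) \<Longrightarrow> wf_height_le (fst x) (H + 2 * log 2 (snd x))"
  shows "wf_height_le (whole d t) (H + 2 * log 2 (wt (inord t)) + 2)"
  using assms
proof (induction t)
  case (Nd l x r)
  let ?W = "wt (inord (Nd l x r))"
  have pos: "snd y > 0" if "y \<in> set (inord (Nd l x r))" for y using Nd.prems halving_pos that by blast
  have nn: "wt (inord l) \<ge> 0" "wt (inord r) \<ge> 0" using pos by (auto intro!: wt_nonneg)
  have "0 < snd x" using pos by simp
  moreover have "snd x \<le> ?W" using nn by simp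
  ultimately have x: "log 2 (snd x) \<le> log 2 ?W" by simp
  have sub: "wf_height_le (whole d c) (H + 2 * log 2 ?W)" if c: "c = l \<or> c = r" for c
  proof (cases "inord c = []")
    case False
    have "snd z > 0" if "z \<in> set (inord c)" for z
      using that pos[of z] c by auto
    then have "1 + log 2 (wt (inord c)) \<le> log 2 ?W"
      using False c Nd.prems by (intro log_wt_half) auto
    moreover have "wf_height_le (whole d c) (H + 2 * log 2 (wt (inord c)) + 2)"
      using c Nd.IH Nd.prems by auto
    ultimately show ?thesis by (auto elim!: wf_height_le_mono)
  next
    case True
    then have "whole d c = None" by (cases c) auto
    then show ?thesis by simp
  qed
  have "wf_height_le (fst x) (H + 2 * log 2 ?W)" using Nd.prems(2)[of x] x by (auto elim!: wf_height_le_mono)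
  then have "wf_height_le (cat d (fst x) (whole d r)) (H + 2 * log 2 ?W + 1)" using sub by (intro wf_height_le_cat) auto
  moreover have "wf_height_le (whole d l) (H + 2 * log 2 ?W + 1)" by (rule wf_height_le_mono[OF sub]) auto
  ultimately have "wf_height_le (whole d (Nd l x r)) (H + 2 * log 2 ?W + 1 + 1)"
    unfolding whole.simps by (rule wf_height_le_cat[rotated])
  then show ?case by (simp add: algebra_simps)
qed simp

text \<open>\<open>Z\<close> bounds the tail and has room for every \<open>whole\<close> used. A
  step to the left makes the tail taller by at most 1, a step to the right keeps it, and both halve
  the weight; so the surplus is charged to the depth of element \<open>i\<close>.\<close>

lemma wf_height_le_tails:
  assumes "halving t" "\<And>x. x \<in> set (inord t) \<Longrightarrow> wf_height_le (fst x) (H + 2 * log 2 (snd x))"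
    "wf_height_le z Z" "H + 2 * log 2 (wt (inord t)) + 2 \<le> Z" "i < length (inord t)"
  shows "wf_height_le (tails d t z ! i) (Z + 2 * (log 2 (wt (inord t)) - log 2 (snd (inord t ! i))) + 1)"
  using assms
proof (induction t arbitrary: z Z i)
  case (Nd l x r)
  let ?W = "wt (inord (Nd l x r))"
  let ?n = "length (inord l)"
  define z' where "z' = cat d (cat d (fst x) (whole d r)) z"
  have t: "tails d (Nd l x r) z = tails d l z' @ z' # tails d r z" by (simp add: z'_def Let_def)
  have pos: "snd y > 0" if "y \<in> set (inord (Nd l x r))" for y using Nd.prems halving_pos that by blast
  have half: "1 + log 2 (wt (inord c)) \<le> log 2 ?W" if c: "c = l \<or> c = r" "inord c \<noteq> []" for c
  proof (rule log_wt_half)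
    show "snd y > 0" if "y \<in> set (inord c)" for y using that pos[of y] c by auto
  qed (use c Nd.prems in auto)
  have nn: "wt (inord l) \<ge> 0" "wt (inord r) \<ge> 0" using pos by (auto intro!: wt_nonneg)
  have "0 < snd x" using pos by simp
  moreover have "snd x \<le> ?W" using nn by simp
  ultimately have x: "log 2 (snd x) \<le> log 2 ?W" by simp
  have "wf_height_le (whole d r) (H + 2 * log 2 ?W)"
  proof (cases "inord r = []")
    case True
    then have "whole d r = None" by (cases r) auto
    then show ?thesis by simp
  next
    case False
    have "wf_height_le (whole d r) (H + 2 * log 2 (wt (inord r)) + 2)"
      using Nd.prems by (intro wf_height_le_whole) auto
    with half[of r] False show ?thesis by (auto elim!: wf_height_le_mono)
  qed
  moreover have "wf_height_le (fst x) (H + 2 * log 2 ?W)" using Nd.prems(2)[of x] x by (auto elim!: wf_height_le_mono)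
  ultimately have "wf_height_le (cat d (fst x) (whole d r)) (H + 2 * log 2 ?W + 1)" by (intro wf_height_le_cat)
  then have "wf_height_le (cat d (fst x) (whole d r)) Z" using Nd.prems(4) by (elim wf_height_le_mono) simp
  then have z': "wf_height_le z' (Z + 1)" unfolding z'_def using Nd.prems(3) by (rule wf_height_le_cat)
  consider "i < ?n" | "i = ?n" | "i > ?n" by linarith
  then show ?case
  proof cases
    case 1
    then have "inord l \<noteq> []" by auto
    then have h: "1 + log 2 (wt (inord l)) \<le> log 2 ?W" by (intro half) auto
    have "wf_height_le (tails d l z' ! i) (Z + 1 + 2 * (log 2 (wt (inord l)) - log 2 (snd (inord l ! i))) + 1)"
      using Nd.prems h 1 z' by (intro Nd.IH(1)) auto
    then have "wf_height_le (tails d l z' ! i) (Z + 2 * (log 2 ?W - log 2 (snd (inord l ! i))) + 1)"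
      using h by (elim wf_height_le_mono) simp
    then show ?thesis using 1 by (simp add: t nth_append length_tails del: tails.simps)
  next
    case 2
    have "wf_height_le z' (Z + 2 * (log 2 ?W - log 2 (snd x)) + 1)" using z' x by (elim wf_height_le_mono) simp
    then show ?thesis using 2 by (simp add: t nth_append length_tails del: tails.simps)
  next
    case 3
    then obtain j where j: "i = ?n + Suc j" by (metis less_iff_Suc_add add_Suc_right)
    then have jl: "j < length (inord r)" using Nd.prems by simp
    then have "inord r \<noteq> []" by auto
    then have h: "1 + log 2 (wt (inord r)) \<le> log 2 ?W" by (intro half) auto
    have "wf_height_le (tails d r z ! j) (Z + 2 * (log 2 (wt (inord r)) - log 2 (snd (inord r ! j))) + 1)"
      using Nd.prems h jl by (intro Nd.IH(2)) auto
    then have "wf_height_le (tails d r z ! j) (Z + 2 * (log 2 ?W - log 2 (snd (inord r ! j))) + 1)"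
      using h by (elim wf_height_le_mono) simp
    then show ?thesis using j by (simp add: t nth_append length_tails del: tails.simps)
  qed
qed simp

section \<open>Balancing\<close>

lemma floor_log_log:
  assumes "x > 0"
  shows "real (floor_log x) \<le> log 2 (real x)" "log 2 (real x) < real (floor_log x) + 1"
proof -
  have "log 2 (real x) \<ge> 0" using assms by simp
  then show "real (floor_log x) \<le> log 2 (real x)" "log 2 (real x) < real (floor_log x) + 1"
    using assms by (auto simp: floor_log_altdef intro: order_trans[OF _ of_int_floor_le])
qed

section \<open>Rebuilding the chains, level by level of \<open>nu\<close>\<close>

context tree_dag
begin

text \<open>Every light edge decreases \<open>nu\<close>, which pays for the constant overhead of one chain; the two
  logarithmic terms telescope along a path from the root.\<close>

definition balanced :: "'a tr set \<Rightarrow> 'a tr \<Rightarrow> 'a tr \<Rightarrow> bool" where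
  "balanced N s t \<longleftrightarrow> yield t = yield s \<and> wft t \<and> subs t \<subseteq> N \<and>
     (ent s > 0 \<longrightarrow> real (height t) \<le>
        13 * nu s + 2 * (log 2 (len T) - log 2 (ent s)) + 2 * log 2 (len s) + 13)"

lemma balanced_mono: "balanced N s t \<Longrightarrow> N \<subseteq> N' \<Longrightarrow> balanced N' s t"
  by (auto simp: balanced_def)

text \<open>A node whose sibling is on the other side contributes the empty string, so both
  sequences are indexed by the chain and the same \<open>i\<close> cuts both. The flag
  \<open>False\<close> reverses the right siblings.\<close>

lemma yield_chain:
  "i \<le> length (butlast (chain s)) \<Longrightarrow> yield (chain s ! i) =
     foldr (app True) (map (\<lambda>x. if heavy_left x then [] else yield (off x)) (drop i (butlast (chain s)))) [] @
     yield (last (chain s)) @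
     foldr (app False) (map (\<lambda>x. if heavy_left x then yield (off x) else []) (drop i (butlast (chain s)))) []"
proof (induction s arbitrary: i rule: chain_induct)
  case (heavy s c)
  show ?case
  proof (cases i)
    case 0
    obtain xs where xs: "chain c = c # xs" using chain_Cons by blast
    have "yield (chain c ! 0) =
      foldr (app True) (map (\<lambda>x. if heavy_left x then [] else yield (off x)) (drop 0 (butlast (chain c)))) [] @
     yield (last (chain c)) @
     foldr (app False) (map (\<lambda>x. if heavy_left x then yield (off x) else []) (drop 0 (butlast (chain c)))) []"
      by (rule heavy.IH) simp
    moreover define a where
      "a = foldr (app True) (map (\<lambda>x. if heavy_left x then [] else yield (off x)) (butlast (chain c))) []"
    moreover define b where
      "b = foldr (app False) (map (\<lambda>x. if heavy_left x then yield (off x) else []) (butlast (chain c))) []"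
    ultimately have c: "yield c = a @ yield (last (chain c)) @ b" by (simp add: xs)
    have app: "app True us vs = us @ vs" "app False us vs = vs @ us" for us vs :: "'a list"
      by (simp_all add: app_def)
    have "yield (chain s ! i) = app True (if heavy_left s then [] else yield (off s)) a @
        yield (last (chain c)) @ app False (if heavy_left s then yield (off s) else []) b"
      unfolding app using 0 yield_off[OF heavy(1)] by (simp add: chain_heavy[OF heavy(1)] c)
    then show ?thesis by (simp add: 0 chain_heavy[OF heavy(1)] a_def b_def)
  next
    case (Suc j)
    then have "j \<le> length (butlast (chain c))" using heavy by (simp add: chain_heavy)
    from heavy.IH[OF this] show ?thesis by (simp add: chain_heavy[OF heavy(1)] Suc)
  qed
qed (simp add: chain_no_heavy)

text \<open>The new nodes form one set \<open>N'\<close> for the whole chain, because the trees of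
  its members share them and are paid for jointly.\<close>

lemma chain_rebuild:
  assumes h: "head h"
    and B: "\<And>x c. x \<in> set (chain h) \<Longrightarrow> light x c \<Longrightarrow> balanced N c (B c)"
  shows "\<exists>N'. finite N' \<and> card N' \<le> 9 * length (chain h) \<and>
           (\<forall>x\<in>set (chain h). \<exists>t. balanced (N \<union> N') x t)"
proof -
  define pre where "pre = butlast (chain h)"
  define z where "z = last (chain h)"
  define m where "m = length pre"
  define f where "f = floor_log (oc h)"
  define e where "e = floor_log (len h)"
  define n where "n = log 2 (len T)"
  \<comment> \<open>The first summand pays for entering the chain at \<open>x\<close>, the second one for leaving it there.\<close>
  define w where "w = (\<lambda>x. ent x / 2 ^ (f + 1) + len (off x) / 2 ^ (e + 1))"
  have hT: "h \<in> subs T" using h by (simp add: head_def)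
  have chain_eq: "chain h = pre @ [z]" by (simp add: pre_def z_def)
  have z: "z \<in> set (chain h)" "\<And>c. \<not> heavy z c" by (simp_all add: chain_eq) (simp add: z_def last_chain)
  have pre: "x \<in> set (chain h)" "light x (off x)" if "x \<in> set pre" for x
    using that butlast_chain off_light by (auto simp: chain_eq) (auto simp: pre_def)
  have inT: "x \<in> subs T" if "x \<in> set (chain h)" for x using chain_in hT that by blast
  have occ_pos': "oc x > 0" and len_pos': "len x > 0" if "x \<in> subs T" for x
    using that wf occ_pos wf_subs len_pos by blast+
  have ranks: "f \<le> log 2 (oc x)" "log 2 (oc x) < f + 1" "e \<le> log 2 (len x)" "log 2 (len x) < e + 1"
    if "x \<in> set (chain h)" for x
    using floor_log_log[of "oc x"] floor_log_log[of "len x"] chain_ranks[OF that] occ_pos' len_pos' inT[OF that]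
    by (auto simp: f_def e_def)
  have fn: "f \<le> n"
  proof -
    have "log 2 (oc h) \<le> n" unfolding n_def using oc_le[OF hT] occ_pos'[OF hT] by simp
    then show ?thesis using ranks(1)[of h] by (simp add: set_chain)
  qed
  \<comment> \<open>The light edge lowers \<open>nu\<close> by at least 1, which pays for the
    summand 13 of the sibling's bound, and \<open>ent (off x)\<close> is at least
    \<open>oc x\<close>, hence at least \<open>2 ^ f\<close>.\<close>
  have off: "real (height (B (off x))) \<le> 13 * nu h + 2 * n - 2 * f + 2 * log 2 (len (off x))"
     "len (off x) > 0" "yield (B (off x)) = yield (off x)" "wft (B (off x))" "subs (B (off x)) \<subseteq> N"
    if "x \<in> set pre" for x
  proof -
    note x = pre[OF that]
    have bal: "balanced N (off x) (B (off x))" using B x by blast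
    then show "yield (B (off x)) = yield (off x)" "wft (B (off x))" "subs (B (off x)) \<subseteq> N"
      by (auto simp: balanced_def)
    show "len (off x) > 0" using x light_in len_pos' by blast
    have "nu (off x) + 1 \<le> nu h" using nu_light[OF x(2)] chain_nu[OF x(1)] by simp
    then have "real (nu (off x)) + 1 \<le> nu h" by linarith
    moreover have "oc x > 0" "oc x \<le> ent (off x)" using occ_pos' inT x ent_light by auto
    then have "ent (off x) > 0" "log 2 (oc x) \<le> log 2 (ent (off x))" by auto
    moreover have "f \<le> log 2 (oc x)" using ranks x by blast
    ultimately show "real (height (B (off x))) \<le> 13 * nu h + 2 * n - 2 * f + 2 * log 2 (len (off x))"
      using bal by (auto simp: balanced_def n_def)
  qed
  \<comment> \<open>\<open>H\<close> bounds the children of the chain's end. Since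
    \<open>log 2 (len (off x))\<close> is at most \<open>log 2 (w x) + (e + 1)\<close>, the siblings
    get the height \<open>H + 2 * log 2 (w x)\<close> that the search tree expects.\<close>
  define H where "H = 13 * real (nu h) + 2 * n - 2 * f + 2 * (e + 1)"
  \<comment> \<open>The chain's end has only light children, so it is put directly on top of their
    balanced trees.\<close>
  define K where "K = (case z of Chr a \<Rightarrow> Chr a | Bin l r \<Rightarrow> Bin (B l) (B r) | Rep u k \<Rightarrow> Rep (B u) k)"
  have zc: "balanced N c (B c)" "real (height (B c)) \<le> H" if "child z c" for c
  proof -
    have c: "light z c" using z inT that by (auto simp: light_def)
    then show bal: "balanced N c (B c)" using B z by blast
    have "nu c + 1 \<le> nu h" using nu_light[OF c] chain_nu[OF z(1)] by simp
    then have "real (nu c) + 1 \<le> nu h" by linarith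
    moreover have "oc z > 0" "oc z \<le> ent c" using occ_pos' inT c z ent_light by auto
    then have "ent c > 0" "log 2 (oc z) \<le> log 2 (ent c)" by auto
    moreover have "f \<le> log 2 (oc z)" "log 2 (len z) < e + 1" using ranks z by blast+
    moreover have "len c > 0" "len c \<le> len z"
      using that light_in[OF c] len_pos' wf_subs by (auto simp: len_child)
    then have "log 2 (len c) \<le> log 2 (len z)" by simp
    ultimately show "real (height (B c)) \<le> H"
      using bal by (auto simp: balanced_def H_def n_def)
  qed
  have H0: "H \<ge> 0" using fn by (simp add: H_def)
  have K: "yield K = yield z" "wf_height_le (Some K) (H + 1)" "subs K \<subseteq> insert K N"
  proof -
    have "wft z" using z inT wf_subs by blast
    then have "yield K = yield z \<and> wft K \<and> real (height K) \<le> H + 1 \<and> subs K \<subseteq> insert K N"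
    proof (cases z)
      case (Bin l r)
      then have "K = Bin (B l) (B r)" by (simp add: K_def)
      then show ?thesis using Bin zc[of l] zc[of r] by (auto simp: balanced_def)
    next
      case (Rep u k)
      then have "K = Rep (B u) k" by (simp add: K_def)
      then show ?thesis using Rep zc[of u] \<open>wft z\<close> by (auto simp: balanced_def)
    qed (use H0 in \<open>simp add: K_def\<close>)
    then show "yield K = yield z" "wf_height_le (Some K) (H + 1)" "subs K \<subseteq> insert K N" by auto
  qed
  \<comment> \<open>Both sequences range over the whole chain, with \<open>None\<close> for a
    sibling on the other side; this gives them equal indices and equal weights.\<close>
  define xs where "xs = (\<lambda>d. map (\<lambda>x. (if heavy_left x = d then None else Some (B (off x)), w x)) pre)"
  have w: "w x > 0" "log 2 (len (off x)) \<le> log 2 (w x) + (e + 1)"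
    "ent x > 0 \<Longrightarrow> log 2 (ent x) \<le> log 2 (w x) + (f + 1)" if "x \<in> set pre" for x
  proof -
    have l: "real (len (off x)) > 0" using off that by simp
    then have "real (len (off x)) / 2 ^ (e + 1) > 0" by simp
    moreover have "real (ent x) / 2 ^ (f + 1) \<ge> 0" by simp
    ultimately show w: "w x > 0" unfolding w_def by linarith
    have "len (off x) \<le> w x * 2 ^ (e + 1)" by (simp add: w_def field_simps)
    then have "log 2 (len (off x)) \<le> log 2 (w x * 2 ^ (e + 1))" using l w by simp
    then show "log 2 (len (off x)) \<le> log 2 (w x) + (e + 1)"
      using w by (simp add: log_mult log_nat_power del: power_Suc)
    assume "ent x > 0"
    moreover have "ent x \<le> w x * 2 ^ (f + 1)" by (simp add: w_def field_simps)
    ultimately have "log 2 (ent x) \<le> log 2 (w x * 2 ^ (f + 1))" using w by simp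
    then show "log 2 (ent x) \<le> log 2 (w x) + (f + 1)"
      using w by (simp add: log_mult log_nat_power del: power_Suc)
  qed
  have "\<exists>t. inord t = xs d \<and> halving t" for d
    using w by (intro halving_exists) (auto simp: xs_def)
  then obtain tt where tt: "\<And>d. inord (tt d) = xs d" "\<And>d. halving (tt d)" by metis
  \<comment> \<open>Entries sum to at most \<open>oc z\<close>, which is below
    \<open>2 ^ (f + 1)\<close>, and sibling lengths to at most \<open>len h\<close>, which is below
    \<open>2 ^ (e + 1)\<close>; each part weighs at most 1.\<close>
  have wt_le: "wt (xs d) \<le> 2" for d
  proof -
    have "wt (xs d) = (\<Sum>x\<leftarrow>pre. w x)" by (simp add: wt_def xs_def comp_def)
    also have "\<dots> = (\<Sum>x\<leftarrow>pre. ent x) / 2 ^ (f + 1) + (\<Sum>x\<leftarrow>pre. len (off x)) / 2 ^ (e + 1)"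
      unfolding w_def by (induction pre) (auto simp: add_divide_distrib)
    also have "\<dots> \<le> 1 + 1"
    proof (rule add_mono)
      have "ent h = oc h" using h by (simp add: head_def ent_no_heavy)
      then have "(\<Sum>x\<leftarrow>pre. ent x) \<le> oc z"
        using sum_ent_chain[of h] by (simp add: chain_eq)
      also have "\<dots> < 2 ^ (f + 1)"
        using floor_log_exp2_gt[of "oc z"] chain_ranks(1)[OF z(1)] by (simp add: f_def)
      finally have "real (\<Sum>x\<leftarrow>pre. ent x) < real (2 ^ (f + 1))" by (simp only: of_nat_less_iff)
      then show "real (\<Sum>x\<leftarrow>pre. ent x) / 2 ^ (f + 1) \<le> 1" by simp
      have "(\<Sum>x\<leftarrow>pre. len (off x)) \<le> len h"
        using sum_len_chain[of h] by (simp add: chain_eq)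
      also have "\<dots> < 2 ^ (e + 1)"
        using floor_log_exp2_gt[of "len h"] by (simp add: e_def)
      finally have "real (\<Sum>x\<leftarrow>pre. len (off x)) < real (2 ^ (e + 1))" by (simp only: of_nat_less_iff)
      then show "real (\<Sum>x\<leftarrow>pre. len (off x)) / 2 ^ (e + 1) \<le> 1" by simp
    qed
    finally show ?thesis by simp
  qed
  have elem: "wf_height_le (fst x) (H + 2 * log 2 (snd x))" if x: "x \<in> set (inord (tt d))" for x d
  proof -
    obtain y where y: "y \<in> set pre" "x = (if heavy_left y = d then None else Some (B (off y)), w y)"
      using x by (auto simp: tt xs_def)
    show ?thesis using y off[OF y(1)] w[OF y(1)] by (auto simp: H_def)
  qed
  define S where "S = (\<lambda>d. tails d (tt d) None)"
  \<comment> \<open>As the weight is at most 2, \<open>Z = H + 4\<close> is admissible, and the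
    height is at most \<open>H + 4 + 2 * (1 - log 2 (w (pre ! i))) + 1\<close>.\<close>
  have S: "wf_height_le (S d ! i) (H + 7 - 2 * log 2 (w (pre ! i)))" if i: "i < m" for d i
  proof -
    have i': "i < length (inord (tt d))" using i by (simp add: tt xs_def m_def)
    have "wt (xs d) > 0" using i w by (intro wt_pos) (auto simp: xs_def m_def)
    then have log_le: "log 2 (wt (inord (tt d))) \<le> 1"
      using wt_le[of d] by (simp add: tt)
    have "wf_height_le (S d ! i) (H + 4 + 2 * (log 2 (wt (inord (tt d))) - log 2 (snd (inord (tt d) ! i))) + 1)"
      unfolding S_def using log_le by (intro wf_height_le_tails[where H = H] tt elem i') auto
    moreover have "snd (inord (tt d) ! i) = w (pre ! i)" using i by (simp add: tt xs_def m_def)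
    ultimately show ?thesis using log_le by (elim wf_height_le_mono) simp
  qed
  define R where "R = (\<lambda>i. cat True (Some K) (S False ! i))"
  define M where "M = (\<lambda>i. cat True (S True ! i) (R i))"
  define N' where "N' = insert K (new_nodes True (tt True) None \<union> new_nodes False (tt False) None \<union>
    (\<Union>i\<in>{..<m}. set_option (R i) \<union> set_option (M i)))"
  have "finite N'" by (auto simp: N'_def finite_new_nodes)
  moreover have "card N' \<le> 9 * length (chain h)"
  proof -
    have nn: "card (new_nodes d (tt d) None) \<le> 3 * m" for d
      using card_new_nodes[of d "tt d" None] by (simp add: tt xs_def m_def)
    have "card (\<Union>i\<in>{..<m}. set_option (R i) \<union> set_option (M i)) \<le>
        (\<Sum>i\<in>{..<m}. card (set_option (R i) \<union> set_option (M i)))" by (rule card_UN_le) simp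
    also have "\<dots> \<le> (\<Sum>i\<in>{..<m}. 2)"
    proof (rule sum_mono)
      fix i
      show "card (set_option (R i) \<union> set_option (M i)) \<le> 2"
        using card_Un_le[of "set_option (R i)" "set_option (M i)"]
          card_set_option[of "R i"] card_set_option[of "M i"] by linarith
    qed
    finally have "card (\<Union>i\<in>{..<m}. set_option (R i) \<union> set_option (M i)) \<le> 2 * m" by simp
    moreover have "card N' \<le> Suc (card (new_nodes True (tt True) None \<union> new_nodes False (tt False) None \<union>
      (\<Union>i\<in>{..<m}. set_option (R i) \<union> set_option (M i))))"
      unfolding N'_def by (rule card_insert_le_m1) auto
    moreover note nn[of True] nn[of False]
      card_Un_le[of "new_nodes True (tt True) None \<union> new_nodes False (tt False) None"
        "\<Union>i\<in>{..<m}. set_option (R i) \<union> set_option (M i)"]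
      card_Un_le[of "new_nodes True (tt True) None" "new_nodes False (tt False) None"]
    \<comment> \<open>Two search trees with at most \<open>3 * m\<close> nodes each, two joins for
      each \<open>i\<close>, and \<open>K\<close>; the chain has \<open>m + 1\<close>
      members.\<close>
    ultimately have "card N' \<le> 8 * m + 1" by linarith
    then show ?thesis by (simp add: chain_eq m_def)
  qed
  moreover have "\<exists>t. balanced (N \<union> N') x t" if x: "x \<in> set (chain h)" for x
  proof -
    have nu: "nu x = nu h" using chain_nu x by blast
    have logent: "log 2 (ent x) < f + 1" if "ent x > 0"
    proof -
      have "log 2 (ent x) \<le> log 2 (oc x)" using that ent_le[of x] by simp
      with ranks(2)[OF x] show ?thesis by linarith
    qed
    have KN: "subs K \<subseteq> N \<union> N'" using K(3) by (auto simp: N'_def)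
    have He: "H + 3 \<le> 13 * nu x + 2 * (n - log 2 (ent x)) + 2 * log 2 (len x) + 13" if "ent x > 0"
      using logent[OF that] ranks(3)[OF x] by (simp add: H_def nu)
    consider "x = z" | i where "i < m" "x = pre ! i"
      using x by (auto simp: chain_eq in_set_conv_nth m_def)
    then show ?thesis
    proof cases
      case 1
      have "balanced (N \<union> N') z K"
        using K KN He unfolding balanced_def 1 n_def by auto
      with 1 show ?thesis by blast
    next
      case (2 i)
      have xp: "x \<in> set pre" using 2 by (auto simp: m_def)
      obtain t where t: "M i = Some t"
        by (cases "S True ! i"; cases "S False ! i") (auto simp: M_def R_def)
      have yS: "yield_opt (S d ! i) = foldr (app d)
          (map (\<lambda>x. if heavy_left x = d then [] else yield (off x)) (drop i pre)) []" for d
      proof -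
        have "yield_opt (S d ! i) = foldr (app d) (drop i (map (yield_opt \<circ> fst) (inord (tt d)))) (yield_opt None)"
          unfolding S_def using 2 by (intro yield_opt_tails) (simp add: tt xs_def m_def)
        also have "map (yield_opt \<circ> fst) (inord (tt d)) = map (\<lambda>x. if heavy_left x = d then [] else yield (off x)) pre"
          using off by (auto simp: tt xs_def)
        finally show ?thesis by (simp add: drop_map)
      qed
      have "yield t = yield_opt (M i)" by (simp add: t)
      also have "\<dots> = yield_opt (S True ! i) @ yield z @ yield_opt (S False ! i)"
        by (simp add: M_def R_def app_def K)
      also have "\<dots> = yield x"
      proof -
        have "x = chain h ! i" using 2 by (simp add: chain_eq nth_append m_def)
        moreover have "(\<lambda>x. if heavy_left x = False then [] else yield (off x)) =
          (\<lambda>x. if heavy_left x then yield (off x) else [])" by auto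
        ultimately show ?thesis using yield_chain[of i h] 2 unfolding yS
          by (simp add: m_def flip: pre_def z_def)
      qed
      finally have yt: "yield t = yield x" .
      have subs_t: "subs t \<subseteq> N \<union> N'"
      proof -
        have S_sub: "subs_opt (S d ! i) \<subseteq> N \<union> N'" for d
        proof -
          have "S d ! i \<in> set (S d)" using 2 by (simp add: S_def length_tails tt xs_def m_def)
          then have "subs_opt (S d ! i) \<subseteq> new_nodes d (tt d) None \<union> (\<Union>x\<in>set (inord (tt d)). subs_opt (fst x)) \<union> subs_opt None"
            unfolding S_def by (rule subs_opt_tails)
          moreover have "(\<Union>x\<in>set (inord (tt d)). subs_opt (fst x)) \<subseteq> N"
          proof
            fix y assume "y \<in> (\<Union>x\<in>set (inord (tt d)). subs_opt (fst x))"
            then obtain x where "x \<in> set pre" "y \<in> subs (B (off x))"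
              by (auto simp: tt xs_def split: if_splits)
            with off(5) show "y \<in> N" by blast
          qed
          moreover have "new_nodes d (tt d) None \<subseteq> N'" by (cases d) (auto simp: N'_def)
          ultimately show ?thesis by auto
        qed
        have "subs_opt (M i) \<subseteq> set_option (M i) \<union> subs_opt (S True ! i) \<union> subs_opt (R i)"
          unfolding M_def by (rule subs_opt_cat)
        moreover have "subs_opt (R i) \<subseteq> set_option (R i) \<union> subs_opt (Some K) \<union> subs_opt (S False ! i)"
          unfolding R_def by (rule subs_opt_cat)
        moreover have "set_option (M i) \<subseteq> N'" "set_option (R i) \<subseteq> N'" using 2 by (auto simp: N'_def)
        ultimately have "subs_opt (M i) \<subseteq> N' \<union> subs_opt (S True ! i) \<union> (N' \<union> subs_opt (Some K) \<union> subs_opt (S False ! i))"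
          by blast
        also have "\<dots> \<subseteq> N \<union> N'" using S_sub[of True] S_sub[of False] KN by simp
        finally show ?thesis by (simp add: t)
      qed
      define r where "r = max (H + 1) (H + 7 - 2 * log 2 (w x))"
      have S_r: "wf_height_le (S d ! i) r" for d using S[OF 2(1), of d] 2 by (elim wf_height_le_mono) (simp add: r_def)
      have "wf_height_le (Some K) r" using K(2) by (elim wf_height_le_mono) (simp add: r_def)
      then have "wf_height_le (R i) (r + 1)" unfolding R_def using S_r by (intro wf_height_le_cat)
      moreover have "wf_height_le (S True ! i) (r + 1)" using S_r by (rule wf_height_le_mono) simp
      ultimately have "wf_height_le (M i) (r + 1 + 1)" unfolding M_def by (intro wf_height_le_cat)
      then have t_r: "wft t" "real (height t) \<le> r + 2" by (simp_all add: t)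
      \<comment> \<open>Replacing \<open>- 2 * log 2 (w x)\<close> by
        \<open>2 * (f + 1) - 2 * log 2 (ent x)\<close> cancels the terms in \<open>f\<close>. The
        constants are 2 from \<open>H\<close>, 7 + 2 from the suffix and the joins, and 2 from
        \<open>f + 1\<close>: this is the origin of 13.\<close>
      have "r + 2 \<le> 13 * nu x + 2 * (n - log 2 (ent x)) + 2 * log 2 (len x) + 13" if "ent x > 0"
        using He[OF that] w(3)[OF xp that] ranks(3)[OF x] by (simp add: r_def H_def nu)
      with t_r yt subs_t have "balanced (N \<union> N') x t" by (auto simp: balanced_def n_def)
      then show ?thesis by blast
    qed
  qed
  ultimately show ?thesis by blast
qed

text \<open>Chains stay within a level of \<open>nu\<close> and their light children lie on lower
  levels. The chains of the heads partition the level, so each node of \<open>T\<close> is charged 9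
  new nodes.\<close>

lemma balance_levels:
  "\<exists>N. finite N \<and> card N \<le> 9 * card {s \<in> subs T. nu s < m} \<and>
     (\<forall>s\<in>subs T. nu s < m \<longrightarrow> (\<exists>t. balanced N s t))"
proof (induction m)
  case 0
  show ?case by (intro exI[of _ "{}"]) simp
next
  case (Suc m)
  then obtain N where N: "finite N" "card N \<le> 9 * card {s \<in> subs T. nu s < m}"
    "\<And>s. s \<in> subs T \<Longrightarrow> nu s < m \<Longrightarrow> \<exists>t. balanced N s t" by blast
  define B where "B = (\<lambda>s. SOME t. balanced N s t)"
  define Hd where "Hd = {h. head h \<and> nu h = m}"
  have "Hd \<subseteq> subs T" by (auto simp: Hd_def head_def)
  then have finH: "finite Hd" using finite_subs finite_subset by blast
  have "\<exists>N'. finite N' \<and> card N' \<le> 9 * length (chain h) \<and>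
           (\<forall>x\<in>set (chain h). \<exists>t. balanced (N \<union> N') x t)" if "h \<in> Hd" for h
  proof (rule chain_rebuild)
    fix x c
    assume "x \<in> set (chain h)" "light x c"
    then have "nu c < m" "c \<in> subs T"
      using nu_light chain_nu light_in that by (force simp: Hd_def)+
    then show "balanced N c (B c)" unfolding B_def using N(3) by (blast intro: someI_ex)
  qed (use that in \<open>simp add: Hd_def\<close>)
  then obtain N' where N': "\<And>h. h \<in> Hd \<Longrightarrow> finite (N' h)"
    "\<And>h. h \<in> Hd \<Longrightarrow> card (N' h) \<le> 9 * length (chain h)"
    "\<And>h x. h \<in> Hd \<Longrightarrow> x \<in> set (chain h) \<Longrightarrow> \<exists>t. balanced (N \<union> N' h) x t" by metis
  let ?N = "N \<union> (\<Union>h\<in>Hd. N' h)"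
  let ?L = "{s \<in> subs T. nu s = m}"
  have "(\<Sum>h\<in>Hd. length (chain h)) = (\<Sum>h\<in>Hd. card (set (chain h)))"
    using distinct_chain distinct_card by (metis (no_types, lifting))
  also have "\<dots> = card (\<Union>h\<in>Hd. set (chain h))"
    using finH head_unique by (intro card_UN_disjoint[symmetric]) (auto simp: Hd_def)
  also have "\<dots> \<le> card ?L"
    using chain_in chain_nu finite_subs[of T]
    by (intro card_mono) (auto simp: Hd_def head_def)
  finally have "(\<Sum>h\<in>Hd. length (chain h)) \<le> card ?L" .
  moreover have "card (\<Union>h\<in>Hd. N' h) \<le> (\<Sum>h\<in>Hd. card (N' h))"
    using finH by (rule card_UN_le)
  moreover have "\<dots> \<le> (\<Sum>h\<in>Hd. 9 * length (chain h))" using N'(2) by (intro sum_mono) auto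
  moreover have "\<dots> = 9 * (\<Sum>h\<in>Hd. length (chain h))" by (simp add: sum_distrib_left)
  moreover have "card ?N \<le> card N + card (\<Union>h\<in>Hd. N' h)" by (rule card_Un_le)
  moreover have "card {s \<in> subs T. nu s < Suc m} = card {s \<in> subs T. nu s < m} + card ?L"
    using finite_subs[of T] by (subst card_Un_disjoint[symmetric]) (auto intro: arg_cong[of _ _ card])
  ultimately have "card ?N \<le> 9 * card {s \<in> subs T. nu s < Suc m}" using N(2) by linarith
  moreover have "finite ?N" using N N' finH by auto
  moreover have "\<exists>t. balanced ?N s t" if s: "s \<in> subs T" "nu s < Suc m" for s
  proof (cases "nu s < m")
    case True
    then show ?thesis using N(3) s balanced_mono by (metis sup_ge1)
  next
    case False
    then have "nu s = m" using s by simp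
    moreover obtain h where h: "head h" "s \<in> set (chain h)" using head_exists s by blast
    ultimately have "h \<in> Hd" using chain_nu by (auto simp: Hd_def)
    moreover from this obtain t where "balanced (N \<union> N' h) s t" using N'(3) h by blast
    ultimately show ?thesis by (intro exI[of _ t]) (auto elim!: balanced_mono)
  qed
  ultimately show ?case by blast
qed

lemma balance:
  "\<exists>t. yield t = yield T \<and> wft t \<and> card (subs t) \<le> 9 * card (subs T) \<and>
     real (height t) \<le> 30 * log 2 (len T) + 13"
proof -
  obtain N where N: "finite N" "card N \<le> 9 * card {s \<in> subs T. nu s < Suc (nu T)}"
    "\<And>s. s \<in> subs T \<Longrightarrow> nu s < Suc (nu T) \<Longrightarrow> \<exists>t. balanced N s t"
    using balance_levels[of "Suc (nu T)"] by blast
  obtain t where t: "balanced N T t" using N(3)[of T] subs_self by auto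
  have "card (subs t) \<le> card N" using t N(1) by (intro card_mono) (auto simp: balanced_def)
  also have "\<dots> \<le> 9 * card {s \<in> subs T. nu s < Suc (nu T)}" by (rule N)
  also have "\<dots> \<le> 9 * card (subs T)"
    using finite_subs by (intro mult_left_mono card_mono) auto
  finally have c: "card (subs t) \<le> 9 * card (subs T)" .
  have "len T > 0" using wf len_pos by blast
  then have "real (floor_log (len T)) \<le> log 2 (len T)" by (rule floor_log_log)
  \<comment> \<open>The root occurs once, so \<open>nu T\<close> is twice
    \<open>floor_log (len T)\<close>; the factors add up to
    \<open>13 * 2 + 2 + 2 = 30\<close>.\<close>
  then have "real (nu T) \<le> 2 * log 2 (len T)" by (simp add: nu_def occ_self)
  then have "real (height t) \<le> 30 * log 2 (len T) + 13"
    using t by (simp add: balanced_def ent_root)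
  with t c show ?thesis by (auto simp: balanced_def)
qed

end

section \<open>From grammars to trees\<close>

primrec bins :: "'a tr list \<Rightarrow> 'a tr" where
  "bins [] = undefined"
| "bins (x # xs) = (if xs = [] then x else Bin x (bins xs))"

text \<open>The binary nodes that a concatenation rule adds to the trees of its variables.\<close>

primrec spine :: "'a tr list \<Rightarrow> 'a tr set" where
  "spine [] = {}"
| "spine (x # xs) = (if xs = [] then {} else insert (bins (x # xs)) (spine xs))"

lemma yield_bins: "ts \<noteq> [] \<Longrightarrow> yield (bins ts) = concat (map yield ts)"
  by (induction ts) auto

lemma wft_bins: "ts \<noteq> [] \<Longrightarrow> wft (bins ts) \<longleftrightarrow> (\<forall>t\<in>set ts. wft t)"
  by (induction ts) auto

lemma finite_spine: "finite (spine ts)"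
  by (induction ts) auto

lemma card_spine: "card (spine ts) \<le> length ts"
  by (induction ts) (auto simp: finite_spine card_insert_if)

lemma subs_bins: "ts \<noteq> [] \<Longrightarrow> subs (bins ts) \<subseteq> spine ts \<union> (\<Union>t\<in>set ts. subs t)"
  by (induction ts) auto

primrec rhs_tree :: "(nat \<Rightarrow> 'a tr) \<Rightarrow> 'a rhs \<Rightarrow> 'a tr" where
  "rhs_tree \<tau> (Term a) = Chr a"
| "rhs_tree \<tau> (Cat Bs) = bins (map \<tau> Bs)"
| "rhs_tree \<tau> (Run B k) = Rep (\<tau> B) k"

primrec rhs_nodes :: "(nat \<Rightarrow> 'a tr) \<Rightarrow> 'a rhs \<Rightarrow> 'a tr set" where
  "rhs_nodes \<tau> (Term a) = {Chr a}"
| "rhs_nodes \<tau> (Cat Bs) = spine (map \<tau> Bs)"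
| "rhs_nodes \<tau> (Run B k) = {Rep (\<tau> B) k}"

lemma rhs_tree_cong: "(\<And>B. B \<in> rhs_vars r \<Longrightarrow> \<sigma> B = \<tau> B) \<Longrightarrow> rhs_tree \<sigma> r = rhs_tree \<tau> r"
  by (cases r) (auto intro: arg_cong[of _ _ bins])

lemma finite_rhs_nodes: "finite (rhs_nodes \<tau> r)"
  by (cases r) (auto simp: finite_spine)

lemma card_rhs_nodes: "card (rhs_nodes \<tau> r) \<le> rhs_size r"
  using card_spine[of "map \<tau> Bs" for Bs] by (cases r) auto

lemma subs_rhs_tree:
  "rhs_ok r \<Longrightarrow> subs (rhs_tree \<tau> r) \<subseteq> rhs_nodes \<tau> r \<union> (\<Union>B\<in>rhs_vars r. subs (\<tau> B))"
proof (cases r)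
  case (Cat Bs)
  assume "rhs_ok r"
  with Cat have "map \<tau> Bs \<noteq> []" by auto
  from subs_bins[OF this] show ?thesis using Cat by auto
qed auto

lemma wft_rhs_tree: "rhs_ok r \<Longrightarrow> (\<And>B. B \<in> rhs_vars r \<Longrightarrow> wft (\<tau> B)) \<Longrightarrow> wft (rhs_tree \<tau> r)"
proof (cases r)
  case (Cat Bs)
  assume "rhs_ok r" and *: "\<And>B. B \<in> rhs_vars r \<Longrightarrow> wft (\<tau> B)"
  with Cat have "map \<tau> Bs \<noteq> []" by auto
  from wft_bins[OF this] show ?thesis using Cat * by auto
qed auto

text \<open>The equations recurse along \<open>rank\<close>, not structurally. Iterated from an
  arbitrary start, they make the value at \<open>A\<close> stable after more than
  \<open>rank A\<close> rounds, and \<open>\<tau>\<close> takes it there.\<close>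

lemma rlslp_tree_map:
  assumes "rlslp G"
  shows "\<exists>\<tau>. \<forall>A r. rules G A = Some r \<longrightarrow> \<tau> A = rhs_tree \<tau> r"
proof -
  from assms obtain rank :: "nat \<Rightarrow> nat"
    where rank: "\<And>A r B. rules G A = Some r \<Longrightarrow> B \<in> rhs_vars r \<Longrightarrow> rank B < rank A"
      and dom: "\<And>A r. rules G A = Some r \<Longrightarrow> rhs_vars r \<subseteq> dom (rules G)"
    unfolding rlslp_def by blast
  define f where "f = rec_nat (\<lambda>_. undefined) (\<lambda>_ g A. rhs_tree g (the (rules G A)))"
  have f: "f (Suc m) A = rhs_tree (f m) (the (rules G A))" for m A by (simp add: f_def)
  define \<tau> where "\<tau> A = f (Suc (rank A)) A" for A
  have *: "f m A = rhs_tree \<tau> r" if "rules G A = Some r" "rank A < m" for A r m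
    using that
  proof (induction "rank A" arbitrary: A r m rule: less_induct)
    case less
    obtain k where k: "m = Suc k" "rank A \<le> k" using less.prems by (cases m) auto
    have "f k B = \<tau> B" if B: "B \<in> rhs_vars r" for B
    proof -
      obtain r' where r': "rules G B = Some r'" using B dom less.prems by blast
      have "rank B < rank A" using rank B less.prems by blast
      with less.hyps[OF _ r', of k] less.hyps[OF _ r', of "Suc (rank B)"] k
      show ?thesis by (simp add: \<tau>_def)
    qed
    then have "rhs_tree (f k) r = rhs_tree \<tau> r" by (rule rhs_tree_cong)
    then show ?case using less.prems by (simp add: k f)
  qed
  show ?thesis
  proof (intro exI allI impI)
    fix A r assume "rules G A = Some r"
    with *[of A r "Suc (rank A)"] show "\<tau> A = rhs_tree \<tau> r" by (simp add: \<tau>_def)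
  qed
qed

text \<open>Each node below the start variable stems from some rule, and a rule contributes at most
  \<open>rhs_size\<close> nodes. Variables with equal trees only make the set smaller.\<close>

lemma rlslp_tree:
  assumes G: "rlslp G" "generates G w"
  shows "\<exists>T. wft T \<and> yield T = w \<and> card (subs T) \<le> grammar_size G"
proof -
  from G(1) obtain rank :: "nat \<Rightarrow> nat"
    where rank: "\<And>A r B. rules G A = Some r \<Longrightarrow> B \<in> rhs_vars r \<Longrightarrow> rank B < rank A"
      and ok: "\<And>A r. rules G A = Some r \<Longrightarrow> rhs_ok r \<and> rhs_vars r \<subseteq> dom (rules G)"
      and fin: "finite (dom (rules G))" and start: "start G \<in> dom (rules G)"
    unfolding rlslp_def by blast
  from rlslp_tree_map[OF G(1)] obtain \<tau> where
    \<tau>: "\<And>A r. rules G A = Some r \<Longrightarrow> \<tau> A = rhs_tree \<tau> r" by blast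
  let ?N = "\<Union>A\<in>dom (rules G). rhs_nodes \<tau> (the (rules G A))"
  have "wft (\<tau> A) \<and> subs (\<tau> A) \<subseteq> ?N" if "rules G A = Some r" for A r
    using that
  proof (induction "rank A" arbitrary: A r rule: less_induct)
    case less
    have IH: "wft (\<tau> B) \<and> subs (\<tau> B) \<subseteq> ?N" if B: "B \<in> rhs_vars r" for B
    proof -
      obtain r' where r': "rules G B = Some r'" using B ok less.prems by blast
      show ?thesis by (rule less.hyps[OF _ r']) (use rank B less.prems in blast)
    qed
    have "rhs_nodes \<tau> r \<subseteq> ?N" using less.prems by force
    then have "subs (\<tau> A) \<subseteq> ?N"
      using subs_rhs_tree[of r \<tau>] ok[OF less.prems] IH unfolding \<tau>[OF less.prems] by blast
    then show ?case using wft_rhs_tree[of r \<tau>] ok[OF less.prems] IH unfolding \<tau>[OF less.prems] by blast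
  qed
  with start have root: "wft (\<tau> (start G))" "subs (\<tau> (start G)) \<subseteq> ?N" by blast+
  have yield: "yield (\<tau> A) = u" if "derives G A u" for A u
    using that
  proof (induction rule: derives.induct)
    case (Cat A Bs us)
    have "map \<tau> Bs \<noteq> []" using ok[OF Cat(1)] by auto
    then have "yield (bins (map \<tau> Bs)) = concat (map (yield \<circ> \<tau>) Bs)" by (simp add: yield_bins)
    moreover have "map (yield \<circ> \<tau>) Bs = us"
      using Cat(2) by (induction rule: list_all2_induct) auto
    ultimately show ?case using \<tau>[OF Cat(1)] by simp
  qed (auto simp: \<tau>)
  have "card (subs (\<tau> (start G))) \<le> card ?N"
    using root fin by (intro card_mono finite_UN_I finite_rhs_nodes)
  also have "\<dots> \<le> (\<Sum>A\<in>dom (rules G). card (rhs_nodes \<tau> (the (rules G A))))"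
    using fin by (rule card_UN_le)
  also have "\<dots> \<le> grammar_size G"
    unfolding grammar_size_def by (intro sum_mono card_rhs_nodes)
  finally show ?thesis using root yield G(2) by (auto simp: generates_def)
qed

lemma balanced_tree_exists:
  assumes "w \<noteq> []"
  shows "\<exists>t. yield t = w \<and> wft t \<and> card (subs t) \<le> 9 * g_rl w \<and>
     real (height t) \<le> 30 * log 2 (length w) + 13"
proof -
  have "\<exists>G. rlslp G \<and> generates G w \<and> grammar_size G = g_rl w"
    unfolding g_rl_def
    by (rule LeastI_ex[of "\<lambda>s. \<exists>G. rlslp G \<and> generates G w \<and> grammar_size G = s"])
      (use rlslp_exists[OF assms] in blast)
  then obtain G where G: "rlslp G" "generates G w" "grammar_size G = g_rl w" by blast
  then obtain T where T: "wft T" "yield T = w" "card (subs T) \<le> g_rl w"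
    using rlslp_tree[OF G(1,2)] by auto
  interpret tree_dag T by standard (rule T)
  obtain t where "yield t = yield T" "wft t" "card (subs t) \<le> 9 * card (subs T)"
     "real (height t) \<le> 30 * log 2 (len T) + 13"
    using balance by blast
  with T length_yield[of T] show ?thesis by (intro exI[of _ t]) auto
qed

section \<open>Range minima on trees\<close>

locale keys =
  fixes rk :: "'a \<Rightarrow> nat" and n :: nat
begin

text \<open>Ordering positions by the key compares symbols first and breaks ties to the left,
  so that a leftmost minimum is a minimum of natural numbers; shifting a block by \<open>d\<close>
  positions adds \<open>d\<close> to all its keys.\<close>

definition key :: "'a list \<Rightarrow> nat \<Rightarrow> nat" where
  "key xs q = rk (xs ! q) * n + q"

definition min_key :: "'a list \<Rightarrow> nat \<Rightarrow> nat \<Rightarrow> nat" where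
  "min_key xs i j = Min (key xs ` {i..<j})"

lemma min_key_shift:
  assumes "d \<le> i" "i < j" "\<And>q. i \<le> q \<Longrightarrow> q < j \<Longrightarrow> xs ! q = ys ! (q - d)"
  shows "min_key xs i j = d + min_key ys (i - d) (j - d)"
proof -
  have "{i..<j} = (\<lambda>q. q + d) ` {i - d..<j - d}" using assms by (simp add: image_add_atLeastLessThan')
  then have "key xs ` {i..<j} = (\<lambda>q. key xs (q + d)) ` {i - d..<j - d}"
    by (simp only: image_image)
  also have "\<dots> = (\<lambda>q. key ys q + d) ` {i - d..<j - d}"
    using assms by (intro image_cong) (auto simp: key_def)
  finally show ?thesis using assms Min_add_commute[of "{i - d..<j - d}" "key ys" d]
    by (simp add: min_key_def)
qed

lemma min_key_split:
  assumes "i < m" "m < j"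
  shows "min_key xs i j = min (min_key xs i m) (min_key xs m j)"
proof -
  have "{i..<j} = {i..<m} \<union> {m..<j}" using assms by auto
  then show ?thesis using assms by (simp add: min_key_def image_Un Min_Un)
qed

text \<open>A symbol repeated further to the right has a larger key than its earlier copy and cannot
  lower the minimum.\<close>

lemma min_key_truncate:
  assumes "m < k" "k \<le> j" "\<And>q. k \<le> q \<Longrightarrow> q < j \<Longrightarrow> \<exists>q'. m \<le> q' \<and> q' < k \<and> xs ! q' = xs ! q"
  shows "min_key xs m j = min_key xs m k"
proof (cases "k = j")
  case False
  then have kj: "k < j" using assms by simp
  have "min_key xs m k \<le> min_key xs k j"
    unfolding min_key_def
  proof (rule Min.boundedI)
    fix a assume "a \<in> key xs ` {k..<j}"
    then obtain q where q: "k \<le> q" "q < j" "a = key xs q" by auto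
    then obtain q' where q': "m \<le> q'" "q' < k" "xs ! q' = xs ! q" using assms(3) by blast
    have "Min (key xs ` {m..<k}) \<le> key xs q'" using q' by (intro Min_le) auto
    also have "\<dots> \<le> a" using q q' by (simp add: key_def)
    finally show "Min (key xs ` {m..<k}) \<le> a" .
  qed (use kj in auto)
  then show ?thesis using min_key_split[OF assms(1) kj] by simp
qed simp

end

text \<open>A leaf is its own child, so that every record of the index contains valid
  addresses.\<close>

primrec c1 :: "'a tr \<Rightarrow> 'a tr" where
  "c1 (Chr a) = Chr a" | "c1 (Bin l r) = l" | "c1 (Rep u k) = u"

primrec c2 :: "'a tr \<Rightarrow> 'a tr" where
  "c2 (Chr a) = Chr a" | "c2 (Bin l r) = r" | "c2 (Rep u k) = u"

primrec is_rep :: "'a tr \<Rightarrow> nat" where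
  "is_rep (Chr a) = 0" | "is_rep (Bin l r) = 0" | "is_rep (Rep u k) = 1"

text \<open>An item \<open>(s, d, i, j)\<close> asks for the positions \<open>i..<j\<close> of \<open>s\<close>, where \<open>s\<close> occurs at offset \<open>d\<close>.\<close>

type_synonym 'a item = "'a tr \<times> nat \<times> nat \<times> nat"

text \<open>The start of the copy that contains \<open>i\<close>. The factor \<open>is_rep s\<close>
  turns it into 0 at a concatenation, so one formula without branching serves both kinds of
  nodes.\<close>

definition first_start :: "'a tr \<Rightarrow> nat \<Rightarrow> nat" where
  "first_start s i = i div len (c1 s) * len (c1 s) * is_rep s"

definition split_pos :: "'a tr \<Rightarrow> nat \<Rightarrow> nat" where
  "split_pos s i = first_start s i + len (c1 s)"

text \<open>In a run, the part right of the copy that contains \<open>i\<close> is cut down to a single copy: later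
  copies only repeat its symbols further to the right.\<close>

fun expand :: "'a item \<Rightarrow> 'a item list" where
  "expand (s, d, i, j) =
     (let st = first_start s i; m = split_pos s i in
      (if i < m then [(c1 s, d + st, i - st, min j m - st)] else []) @
      (if m < j then [(c2 s, d + m, i - m, min (j - m) (len (c2 s)))] else []))"

fun full :: "'a item \<Rightarrow> bool" where
  "full (s, d, i, j) \<longleftrightarrow> j - i = len s"

fun valid :: "'a tr \<Rightarrow> 'a item \<Rightarrow> bool" where
  "valid t (s, d, i, j) \<longleftrightarrow> s \<in> subs t \<and> i < j \<and> j \<le> len s \<and> d + len s \<le> len t"

text \<open>A bound for the number of items processed. A general item of height \<open>h\<close>
  leaves at worst a suffix and a prefix item, and \<open>2 * (2 * (h - 1) + 1)\<close> or a lower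
  general item is below \<open>4 * h + 1\<close>. A one-sided item leaves at worst a full item,
  worth 1, and a lower one-sided item.\<close>

fun pot :: "'a item \<Rightarrow> nat" where
  "pot (s, d, i, j) = (if j - i = len s then 1
     else if i = 0 \<or> j = len s then 2 * height s + 1 else 4 * height s + 1)"

fun item_height :: "'a item \<Rightarrow> nat" where
  "item_height (s, d, i, j) = height s"

lemma pot_le: "j - i = len s \<Longrightarrow> pot (s, d, i, j) = 1"
  "i = 0 \<or> j = len s \<Longrightarrow> pot (s, d, i, j) \<le> 2 * height s + 1"
  "pot (s, d, i, j) \<le> 4 * height s + 1"
  by auto

lemma nth_concat_replicate:
  "q < k * length xs \<Longrightarrow> concat (replicate k xs) ! q = xs ! (q mod length xs)"
proof (induction k arbitrary: q)
  case (Suc k)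
  show ?case
  proof (cases "q < length xs")
    case False
    then have "concat (replicate k xs) ! (q - length xs) = xs ! ((q - length xs) mod length xs)"
      using Suc by (intro Suc.IH) simp
    then show ?thesis using False by (simp add: nth_append le_mod_geq)
  qed (simp add: nth_append)
qed simp

text \<open>A leaf cannot occur, since a nonempty range of it is full. In a run, \<open>c\<close> is
  the index of the copy that contains \<open>i\<close>.\<close>

lemma nonfull_cases:
  assumes v: "valid t (s, d, i, j)" and wf: "wft t" and nf: "\<not> full (s, d, i, j)"
  obtains
    (Bin) l r where "s = Bin l r" "first_start s i = 0" "split_pos s i = len l" "len l > 0" "len r > 0"
  | (Rep) u k c where "s = Rep u k" "len u > 0" "c < k" "first_start s i = c * len u"
      "split_pos s i = Suc c * len u" "c * len u \<le> i" "i < Suc c * len u" "Suc c * len u \<le> k * len u"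
proof (cases s)
  case (Chr a)
  with v nf have False by auto
  then show ?thesis ..
next
  case (Bin l r)
  have "wft s" using v wf wft_subs by auto
  with Bin that(1) show ?thesis by (auto simp: first_start_def split_pos_def len_pos)
next
  case (Rep u k)
  have "wft s" using v wf wft_subs by auto
  then have u: "len u > 0" using Rep by (auto simp: len_pos)
  let ?c = "i div len u"
  have ik: "i < k * len u" using v Rep by auto
  then have c: "?c < k" using u by (simp add: less_mult_imp_div_less)
  then have "Suc ?c * len u \<le> k * len u" by (intro mult_le_mono1) simp
  moreover have "?c * len u \<le> i" "i < Suc ?c * len u"
    using u dividend_less_div_times[of "len u" i] by (auto simp: add.commute)
  ultimately show ?thesis using that(2)[of u k ?c] u c Rep by (auto simp: first_start_def split_pos_def)
qed

context keys
begin

fun item_key :: "'a item \<Rightarrow> nat" where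
  "item_key (s, d, i, j) = d + min_key (yield s) i j"

lemma item_key_expand:
  assumes v: "valid t it" and wf: "wft t" and nf: "\<not> full it"
  shows "expand it \<noteq> [] \<and> item_key it = Min (item_key ` set (expand it))"
proof -
  obtain s d i j where it: "it = (s, d, i, j)" by (cases it)
  have ij: "i < j" "j \<le> len s" using v it by auto
  show ?thesis
  proof (rule nonfull_cases[OF v[unfolded it] wf nf[unfolded it]])
    fix l r
    assume s: "s = Bin l r" "first_start s i = 0" "split_pos s i = len l" "len l > 0" "len r > 0"
    have L: "min_key (yield s) i j = min_key (yield l) i j" if "i < j" "j \<le> len l" for i j
      using min_key_shift[of 0 i j "yield s" "yield l"] that s(1) by (simp add: nth_append length_yield)
    have R: "min_key (yield s) i j = len l + min_key (yield r) (i - len l) (j - len l)" if "i < j" "len l \<le> i" for i j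
      using that s(1) by (intro min_key_shift) (auto simp: nth_append length_yield)
    have j: "min (j - len l) (len r) = j - len l" using ij s by simp
    consider "j \<le> len l" | "len l \<le> i" | "i < len l" "len l < j" by linarith
    then show ?thesis
    proof cases
      case 3
      then have "min_key (yield s) i j = min (min_key (yield l) i (len l)) (len l + min_key (yield r) 0 (j - len l))"
        using min_key_split[of i "len l" j "yield s"] L[of i "len l"] R[of "len l" j] by simp
      then show ?thesis using 3 s j by (simp add: it Let_def min_add_distrib_right)
    qed (use ij s L[of i j] R[of i j] j in \<open>auto simp: it Let_def\<close>)
  next
    fix u k c
    assume s: "s = Rep u k" "len u > 0" "c < k" "first_start s i = c * len u"
      "split_pos s i = Suc c * len u" "c * len u \<le> i" "i < Suc c * len u" "Suc c * len u \<le> k * len u"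
    have nth: "yield s ! q = yield u ! (q mod len u)" if "q < k * len u" for q
      using that s(1) nth_concat_replicate[of q k "yield u"] by (simp add: length_yield)
    have block: "min_key (yield s) i' j' = c' * len u + min_key (yield u) (i' - c' * len u) (j' - c' * len u)"
      if "i' < j'" "c' * len u \<le> i'" "j' \<le> Suc c' * len u" "Suc c' * len u \<le> k * len u" for i' j' c'
    proof (rule min_key_shift)
      fix q assume "i' \<le> q" "q < j'"
      then have q: "c' * len u \<le> q" "q - c' * len u < len u" "q < k * len u" using that by auto
      then have "q mod len u = q - c' * len u"
        by (metis le_add_diff_inverse mod_less mod_mult_self3)
      then show "yield s ! q = yield u ! (q - c' * len u)" using nth q by simp
    qed (use that in auto)
    let ?m = "Suc c * len u"
    show ?thesis
    proof (cases "?m < j")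
      case False
      then have "min_key (yield s) i j = c * len u + min_key (yield u) (i - c * len u) (j - c * len u)"
        using s ij by (intro block) auto
      then show ?thesis using False s by (simp add: it Let_def min_def)
    next
      case True
      have "Suc c < k"
      proof (rule ccontr)
        assume "\<not> Suc c < k"
        then have "k = Suc c" using s by simp
        with True ij s show False by simp
      qed
      then have "Suc (Suc c) * len u \<le> k * len u" by (intro mult_le_mono1) simp
      moreover define k' where "k' = min j (Suc (Suc c) * len u)"
      ultimately have k': "?m < k'" "k' \<le> Suc (Suc c) * len u" "k' \<le> j" "Suc (Suc c) * len u \<le> k * len u"
        using True s by auto
      \<comment> \<open>Beyond the first copy after \<open>?m\<close> the run only repeats: the
        witness has the same residue within that copy. If the range ends inside that copy,
        \<open>k' = j\<close> and nothing is cut.\<close>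
      have "min_key (yield s) ?m j = min_key (yield s) ?m k'"
      proof (rule min_key_truncate)
        fix q assume q: "k' \<le> q" "q < j"
        then have q': "Suc (Suc c) * len u \<le> q" "q < k * len u" using ij s by (auto simp: k'_def)
        have "?m + q mod len u < k'"
          using q q' s(2) mod_less_divisor[of "len u" q] by (auto simp: k'_def)
        moreover have "(?m + q mod len u) mod len u = q mod len u"
          by (simp only: mod_mult_self3 mod_mod_trivial)
        moreover have "?m + q mod len u < k * len u" using calculation k' by linarith
        ultimately show "\<exists>q'. ?m \<le> q' \<and> q' < k' \<and> yield s ! q' = yield s ! q"
          using nth q' by (intro exI[of _ "?m + q mod len u"]) auto
      qed (use k' in auto)
      also have "\<dots> = ?m + min_key (yield u) (?m - ?m) (k' - ?m)"
        using k' by (intro block) auto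
      also have "k' - ?m = min (j - ?m) (len u)" by (auto simp: k'_def min_def)
      finally have R: "min_key (yield s) ?m j = ?m + min_key (yield u) 0 (min (j - ?m) (len u))" by simp
      have L: "min_key (yield s) i ?m = c * len u + min_key (yield u) (i - c * len u) (?m - c * len u)"
        using s by (intro block) auto
      have "min_key (yield s) i j = min (min_key (yield s) i ?m) (min_key (yield s) ?m j)"
        using s True by (intro min_key_split) auto
      then have "d + min_key (yield s) i j = min (d + min_key (yield s) i ?m) (d + min_key (yield s) ?m j)"
        by (simp add: min_add_distrib_right)
      moreover have "expand it = [(u, d + c * len u, i - c * len u, ?m - c * len u),
          (u, d + ?m, 0, min (j - ?m) (len u))]"
        using s True by (simp add: it Let_def)
      ultimately show ?thesis unfolding it item_key.simps L R by (simp add: it add.assoc del: expand.simps mult_Suc)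
    qed
  qed
qed

end

lemma expand_valid:
  assumes v: "valid t it" and wf: "wft t" and nf: "\<not> full it" and "it' \<in> set (expand it)"
  shows "valid t it' \<and> item_height it' < item_height it"
proof -
  obtain s d i j where it: "it = (s, d, i, j)" by (cases it)
  have ij: "i < j" "j \<le> len s" "s \<in> subs t" "d + len s \<le> len t" using v it by auto
  show ?thesis
  proof (rule nonfull_cases[OF v[unfolded it] wf nf[unfolded it]])
    fix l r
    assume s: "s = Bin l r" "first_start s i = 0" "split_pos s i = len l" "len l > 0" "len r > 0"
    have "l \<in> subs t" "r \<in> subs t" using ij(3) s subs_trans[of s t] by (auto simp: subs_self)
    then show ?thesis using assms(4) ij s by (auto simp: it Let_def split: if_splits)
  next
    fix u k c
    assume s: "s = Rep u k" "len u > 0" "c < k" "first_start s i = c * len u"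
      "split_pos s i = Suc c * len u" "c * len u \<le> i" "i < Suc c * len u" "Suc c * len u \<le> k * len u"
    have u: "u \<in> subs t" using ij(3) s subs_trans[of s t] by (auto simp: subs_self)
    have "Suc (Suc c) * len u \<le> k * len u" if "Suc c * len u < j"
    proof -
      have "Suc c * len u < k * len u" using that ij s by simp
      then have "Suc c < k" by (metis mult_less_cancel2)
      then show ?thesis by (intro mult_le_mono1) simp
    qed
    with assms(4) ij s u show ?thesis by (auto simp: it Let_def split: if_splits)
  qed
qed

lemma expand_pot:
  assumes v: "valid t it" and wf: "wft t" and nf: "\<not> full it"
  shows "(\<Sum>x\<leftarrow>expand it. pot x) < pot it"
proof -
  obtain s d i j where it: "it = (s, d, i, j)" by (cases it)
  have ij: "i < j" "j \<le> len s" "j - i \<noteq> len s" using v nf it by auto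
  show ?thesis
  proof (rule nonfull_cases[OF v[unfolded it] wf nf[unfolded it]])
    fix l r
    assume s: "s = Bin l r" "first_start s i = 0" "split_pos s i = len l" "len l > 0" "len r > 0"
    consider "j \<le> len l" | "len l \<le> i" | "i < len l" "len l < j" by linarith
    then show ?thesis by cases (use ij s in \<open>auto simp: it Let_def\<close>)
  next
    fix u k c
    assume s: "s = Rep u k" "len u > 0" "c < k" "first_start s i = c * len u"
      "split_pos s i = Suc c * len u" "c * len u \<le> i" "i < Suc c * len u" "Suc c * len u \<le> k * len u"
    let ?m = "Suc c * len u"
    show ?thesis
    proof (cases "?m < j")
      case False
      then have e: "expand it = [(u, d + c * len u, i - c * len u, j - c * len u)]"
        using s by (simp add: it Let_def min_def)
      have "j - c * len u = len u" if "j = len s" using that False s by simp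
      then show ?thesis unfolding e using ij s by (auto simp: it)
    next
      case True
      define x where "x = (u, d + c * len u, i - c * len u, len u)"
      define y where "y = (u, d + ?m, 0::nat, min (j - ?m) (len u))"
      have e: "expand it = [x, y]" using s True by (simp add: it Let_def x_def y_def)
      have "pot x \<le> 2 * height u + 1" "pot y \<le> 2 * height u + 1"
        unfolding x_def y_def by (intro pot_le; simp)+
      moreover have "pot x = 1" if "i = 0" using that s by (simp add: x_def)
      \<comment> \<open>A range reaching the end of the run contains the next copy entirely, and
        cutting down to this copy makes \<open>y\<close> full. Thus a suffix query continues in only
        one child.\<close>
      moreover have "pot y = 1" if "j = len s"
      proof -
        have "Suc c * len u < k * len u" using that True s by simp
        then have "Suc c < k" by (metis mult_less_cancel2)
        then have "Suc (Suc c) * len u \<le> k * len u" by (intro mult_le_mono1) simp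
        then show ?thesis using that s by (simp add: y_def)
      qed
      ultimately show ?thesis unfolding e using ij s by (auto simp: it)
    qed
  qed
qed

lemma length_expand: "length (expand it) \<le> 2"
  by (cases it) (simp add: Let_def)

section \<open>The query program\<close>

primrec loop_free :: "com \<Rightarrow> bool" where
  "loop_free Skip \<longleftrightarrow> True"
| "loop_free (SetReg x e) \<longleftrightarrow> True"
| "loop_free (SetWork e1 e2) \<longleftrightarrow> True"
| "loop_free (Seq c d) \<longleftrightarrow> loop_free c \<and> loop_free d"
| "loop_free (Cond e c d) \<longleftrightarrow> loop_free c \<and> loop_free d"
| "loop_free (While e c) \<longleftrightarrow> False"

text \<open>A functional semantics lets the simplifier execute loop-free code; the relation
  \<open>exec\<close> is needed only for time and for the loop.\<close>

primrec eval_com :: "nat \<Rightarrow> nat list \<Rightarrow> com \<Rightarrow> mem \<Rightarrow> mem" where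
  "eval_com b D Skip s = s"
| "eval_com b D (SetReg x e) s = s\<lparr>regs := (regs s)(x := expr_val b D s e)\<rparr>"
| "eval_com b D (SetWork e1 e2) s = s\<lparr>work := (work s)(expr_val b D s e1 := expr_val b D s e2)\<rparr>"
| "eval_com b D (Seq c d) s = eval_com b D d (eval_com b D c s)"
| "eval_com b D (Cond e c d) s = (if expr_val b D s e \<noteq> 0 then eval_com b D c s else eval_com b D d s)"
| "eval_com b D (While e c) s = s"

primrec com_cost :: "com \<Rightarrow> nat" where
  "com_cost Skip = 1"
| "com_cost (SetReg x e) = 1 + expr_cost e"
| "com_cost (SetWork e1 e2) = 1 + expr_cost e1 + expr_cost e2"
| "com_cost (Seq c d) = com_cost c + com_cost d"
| "com_cost (Cond e c d) = 1 + expr_cost e + max (com_cost c) (com_cost d)"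
| "com_cost (While e c) = 0"

lemma exec_loop_free:
  "loop_free c \<Longrightarrow> \<exists>t \<le> com_cost c. exec b D c s t (eval_com b D c s)"
proof (induction c arbitrary: s)
  case Skip
  have "exec b D Skip s 1 s" by (rule exec.Skip)
  then show ?case by auto
next
  case (SetReg x e)
  show ?case using exec.SetReg[of b D x e s] by auto
next
  case (SetWork e1 e2)
  show ?case using exec.SetWork[of b D e1 e2 s] by auto
next
  case (Seq c d)
  then obtain t1 t2 where "t1 \<le> com_cost c" "exec b D c s t1 (eval_com b D c s)"
    "t2 \<le> com_cost d" "exec b D d (eval_com b D c s) t2 (eval_com b D d (eval_com b D c s))"
    by fastforce
  then show ?case by (auto intro!: exI[of _ "t1 + t2"] exec.Seq)
next
  case (Cond e c d)
  then obtain t1 t2 where t: "t1 \<le> com_cost c" "exec b D c s t1 (eval_com b D c s)"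
    "t2 \<le> com_cost d" "exec b D d s t2 (eval_com b D d s)"
    by fastforce
  show ?case
  proof (cases "expr_val b D s e = 0")
    case True
    then have "exec b D (Cond e c d) s (1 + expr_cost e + t2) (eval_com b D (Cond e c d) s)"
      using t exec.CondFalse by simp
    then show ?thesis using t by (intro exI[of _ "1 + expr_cost e + t2"]) auto
  next
    case False
    then have "exec b D (Cond e c d) s (1 + expr_cost e + t1) (eval_com b D (Cond e c d) s)"
      using t exec.CondTrue by simp
    then show ?thesis using t by (intro exI[of _ "1 + expr_cost e + t1"]) auto
  qed
qed simp

abbreviation (input) add :: "expr \<Rightarrow> expr \<Rightarrow> expr" where "add \<equiv> Op Add"
abbreviation (input) sub :: "expr \<Rightarrow> expr \<Rightarrow> expr" where "sub \<equiv> Op Sub"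
abbreviation (input) mul :: "expr \<Rightarrow> expr \<Rightarrow> expr" where "mul \<equiv> Op Mul"

text \<open>Register 2 is the stack pointer and register 3 the minimal key found so far. A stack frame
  consists of the four words of an item, which are loaded into the registers 4 to 7.
  The record of a subtree consists of its length, its minimal key, the addresses of its two
  children and a flag for runs.\<close>

definition push :: "expr \<Rightarrow> expr \<Rightarrow> expr \<Rightarrow> expr \<Rightarrow> com" where
  "push e1 e2 e3 e4 =
     Seq (SetWork (Reg 2) e1) (Seq (SetWork (add (Reg 2) (Const 1)) e2)
     (Seq (SetWork (add (Reg 2) (Const 2)) e3) (Seq (SetWork (add (Reg 2) (Const 3)) e4)
     (SetReg 2 (add (Reg 2) (Const 4))))))"

definition pop :: com where
  "pop = Seq (SetReg 2 (sub (Reg 2) (Const 4))) (Seq (SetReg 4 (Work (Reg 2)))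
     (Seq (SetReg 5 (Work (add (Reg 2) (Const 1)))) (Seq (SetReg 6 (Work (add (Reg 2) (Const 2))))
     (SetReg 7 (Work (add (Reg 2) (Const 3)))))))"

definition update :: com where
  "update = Seq (SetReg 8 (add (Reg 5) (Index (add (Reg 4) (Const 1)))))
     (Cond (Op Less (Reg 8) (Reg 3)) (SetReg 3 (Reg 8)) Skip)"

text \<open>Registers 8 and 9 receive the children, 10 and 11 their lengths (the first word of a
  record), and 12 and 13 the values of \<open>first_start\<close> and
  \<open>split_pos\<close>.\<close>

definition load :: com where
  "load = Seq (SetReg 8 (Index (add (Reg 4) (Const 2)))) (Seq (SetReg 9 (Index (add (Reg 4) (Const 3))))
     (Seq (SetReg 10 (Index (Reg 8))) (Seq (SetReg 11 (Index (Reg 9)))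
     (Seq (SetReg 12 (mul (mul (Op Div (Reg 6) (Reg 10)) (Reg 10)) (Index (add (Reg 4) (Const 4)))))
     (SetReg 13 (add (Reg 12) (Reg 10)))))))"

definition push_right :: com where
  "push_right = Cond (Op Less (Reg 13) (Reg 7))
     (Seq (SetReg 14 (sub (Reg 7) (Reg 13)))
     (Seq (Cond (Op Less (Reg 11) (Reg 14)) (SetReg 14 (Reg 11)) Skip)
     (push (Reg 9) (add (Reg 5) (Reg 13)) (sub (Reg 6) (Reg 13)) (Reg 14)))) Skip"

definition push_left :: com where
  "push_left = Cond (Op Less (Reg 6) (Reg 13))
     (Seq (SetReg 14 (Reg 7))
     (Seq (Cond (Op Less (Reg 13) (Reg 14)) (SetReg 14 (Reg 13)) Skip)
     (push (Reg 8) (add (Reg 5) (Reg 12)) (sub (Reg 6) (Reg 12)) (sub (Reg 14) (Reg 12))))) Skip"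

text \<open>The right part is pushed before the left one, so the stack ends up in the order of
  \<open>expand\<close>.\<close>

definition body :: com where
  "body = Seq pop (Cond (Op Equal (sub (Reg 7) (Reg 6)) (Index (Reg 4))) update
     (Seq load (Seq push_right push_left)))"

text \<open>The root's record is at address 1 and word 0 holds \<open>n\<close>. The range becomes
  0-based and half-open; \<open>n * n\<close> exceeds every key of the string and serves as
  infinity.\<close>

definition init :: com where
  "init = Seq (push (Const 1) (Const 0) (sub (Reg 0) (Const 1)) (Reg 1))
     (SetReg 3 (mul (Index (Const 0)) (Index (Const 0))))"

text \<open>A key modulo \<open>n\<close> is its 0-based position.\<close>

definition finish :: com where
  "finish = SetReg 0 (add (Op Mod (Reg 3) (Index (Const 0))) (Const 1))"

definition rmq_prog :: com where
  "rmq_prog = Seq init (Seq (While (Reg 2) body) finish)"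

lemmas com_defs = push_def pop_def update_def load_def push_right_def push_left_def

lemma loop_free_body: "loop_free body"
  by (simp add: body_def com_defs)

fun stack :: "('a tr \<Rightarrow> nat) \<Rightarrow> (nat \<Rightarrow> nat) \<Rightarrow> 'a item list \<Rightarrow> bool" where
  "stack adr W [] \<longleftrightarrow> True"
| "stack adr W ((u, d, i, j) # \<sigma>) \<longleftrightarrow> stack adr W \<sigma> \<and>
     W (4 * length \<sigma>) = adr u \<and> W (4 * length \<sigma> + 1) = d \<and>
     W (4 * length \<sigma> + 2) = i \<and> W (4 * length \<sigma> + 3) = j"

lemma stack_upd: "4 * length \<sigma> \<le> a \<Longrightarrow> stack adr (W(a := x)) \<sigma> = stack adr W \<sigma>"
  by (induction adr W \<sigma> rule: stack.induct) auto

text \<open>The bound on the word length exceeds addresses, keys shifted by an offset, and stack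
  pointers, so no operation of a run is truncated.\<close>

locale machine = keys rk n for rk :: "'a \<Rightarrow> nat" and n +
  fixes b :: nat and D :: "nat list" and t :: "'a tr" and adr :: "'a tr \<Rightarrow> nat"
  assumes wf: "wft t" and len_t: "len t = n"
    and rk: "\<And>a. a \<in> set (yield t) \<Longrightarrow> rk a < n"
    and D0: "D \<noteq> []" "D ! 0 = n" "adr t = 1"
    and D: "\<And>u. u \<in> subs t \<Longrightarrow> adr u + 4 < length D \<and> D ! adr u = len u \<and>
       D ! (adr u + 1) = min_key (yield u) 0 (len u) \<and> D ! (adr u + 2) = adr (c1 u) \<and>
       D ! (adr u + 3) = adr (c2 u) \<and> D ! (adr u + 4) = is_rep u"
    and word: "length D + n * n + 10 * n + 100 < 2 ^ b"
begin

lemma word_eq: "x \<le> length D + n * n + 10 * n + 100 \<Longrightarrow> take_bit b x = x"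
  using word by (intro take_bit_nat_eq_self) linarith

lemma b_ge: "2 \<le> b"
proof (rule ccontr)
  assume "\<not> 2 \<le> b"
  then have "b = 0 \<or> b = 1" by auto
  with word show False by auto
qed

definition state :: "mem \<Rightarrow> 'a item list \<Rightarrow> nat \<Rightarrow> bool" where
  "state s \<sigma> m \<longleftrightarrow> regs s 2 = 4 * length \<sigma> \<and> regs s 3 = m \<and> stack adr (work s) \<sigma>"

text \<open>Keeps the stack pointer linear in \<open>n\<close>: an item above \<open>k\<close>
  others has height at most \<open>n - k\<close>. Replacing an item by at most two lower ones
  preserves this.\<close>

fun fits :: "'a item list \<Rightarrow> bool" where
  "fits [] \<longleftrightarrow> True"
| "fits (it # \<sigma>) \<longleftrightarrow> fits \<sigma> \<and> valid t it \<and> length \<sigma> + item_height it \<le> n"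

text \<open>The expressions are evaluated between the writes of the frame, so their values must not
  depend on the working memory.\<close>

lemma eval_push:
  assumes "regs s 2 = 4 * k" "k \<le> n + 2"
    "\<And>W. expr_val b D (s\<lparr>work := W\<rparr>) e1 = v1" "\<And>W. expr_val b D (s\<lparr>work := W\<rparr>) e2 = v2"
    "\<And>W. expr_val b D (s\<lparr>work := W\<rparr>) e3 = v3" "\<And>W. expr_val b D (s\<lparr>work := W\<rparr>) e4 = v4"
  shows "eval_com b D (push e1 e2 e3 e4) s = s\<lparr>regs := (regs s)(2 := 4 * k + 4),
     work := (work s)(4 * k := v1, 4 * k + 1 := v2, 4 * k + 2 := v3, 4 * k + 3 := v4)\<rparr>"
proof -
  have v1: "expr_val b D s e1 = v1" using assms(3)[of "work s"] by simp
  show ?thesis using assms(1,2) v1 assms(4-6) b_ge by (simp add: push_def word_eq)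
qed

lemma state_push:
  assumes "state s \<sigma> m"
  shows "state (s\<lparr>regs := (regs s)(2 := 4 * length \<sigma> + 4),
     work := (work s)(4 * length \<sigma> := adr u, 4 * length \<sigma> + 1 := d, 4 * length \<sigma> + 2 := i, 4 * length \<sigma> + 3 := j)\<rparr>)
     ((u, d, i, j) # \<sigma>) m"
  using assms by (simp add: state_def stack_upd)

lemma eval_pop:
  assumes "state s ((u, d, i, j) # \<sigma>) m" "length \<sigma> \<le> n"
  defines "s' \<equiv> eval_com b D pop s"
  shows "state s' \<sigma> m" "regs s' 4 = adr u" "regs s' 5 = d" "regs s' 6 = i" "regs s' 7 = j"
proof -
  have 2: "regs s 2 = 4 * length \<sigma> + 4" using assms by (simp add: state_def)
  have "s' = s\<lparr>regs := (regs s)(2 := 4 * length \<sigma>, 4 := adr u, 5 := d, 6 := i, 7 := j)\<rparr>"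
    using assms(1,2) 2 b_ge unfolding s'_def pop_def by (simp add: word_eq state_def)
  then show "state s' \<sigma> m" "regs s' 4 = adr u" "regs s' 5 = d" "regs s' 6 = i" "regs s' 7 = j"
    using assms by (simp_all add: state_def)
qed

lemma min_key_le: "u \<in> subs t \<Longrightarrow> min_key (yield u) 0 (len u) \<le> n * n"
proof -
  assume u: "u \<in> subs t"
  then have "wft u" using wf wft_subs by blast
  then have len: "len u > 0" by (rule len_pos)
  have "set (yield u) \<subseteq> set (yield t)" using u wf
    by (induction t) (auto split: if_splits)
  then have "rk (yield u ! 0) < n" using rk len length_yield[of u] by (metis nth_mem subsetD)
  then have "key (yield u) 0 \<le> n * n" by (simp add: key_def)
  moreover have "min_key (yield u) 0 (len u) \<le> key (yield u) 0"
    unfolding min_key_def using len by (intro Min_le) auto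
  ultimately show ?thesis by linarith
qed

lemma len_le: "u \<in> subs t \<Longrightarrow> len u \<le> n"
  using len_subs[of u t] wf len_t by simp

lemma children: "u \<in> subs t \<Longrightarrow> c1 u \<in> subs t" "u \<in> subs t \<Longrightarrow> c2 u \<in> subs t"
  using subs_trans[of u t] by (cases u; auto simp: subs_self)+

lemma eval_update:
  assumes "state s \<sigma> m" "regs s 4 = adr u" "regs s 5 = d" "u \<in> subs t" "d + len u \<le> n"
  shows "state (eval_com b D update s) \<sigma> (min m (d + min_key (yield u) 0 (len u)))"
proof -
  note D' = D[OF assms(4)] min_key_le[OF assms(4)]
  show ?thesis using assms D' b_ge by (simp add: update_def word_eq state_def)
qed

definition loaded :: "mem \<Rightarrow> 'a item \<Rightarrow> bool" where
  "loaded s it = (case it of (u, d, i, j) \<Rightarrow> regs s 5 = d \<and> regs s 6 = i \<and> regs s 7 = j \<and>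
     regs s 8 = adr (c1 u) \<and> regs s 9 = adr (c2 u) \<and> regs s 11 = len (c2 u) \<and>
     regs s 12 = first_start u i \<and> regs s 13 = split_pos u i)"

lemma first_start_le: "first_start u i \<le> i"
  by (cases u) (auto simp: first_start_def)

lemma eval_load:
  assumes "state s \<sigma> m" "regs s 4 = adr u" "regs s 5 = d" "regs s 6 = i" "regs s 7 = j"
    "valid t (u, d, i, j)"
  shows "state (eval_com b D load s) \<sigma> m" "loaded (eval_com b D load s) (u, d, i, j)"
proof -
  have u: "u \<in> subs t" and i: "i \<le> n" using assms len_le[of u] by auto
  have "len (c1 u) \<le> n" using len_le children u by blast
  moreover have "i div len (c1 u) \<le> n" "i div len (c1 u) * len (c1 u) \<le> n"
    using i div_le_dividend[of i "len (c1 u)"] div_times_less_eq_dividend[of i "len (c1 u)"] by linarith+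
  moreover have "i div len (c1 u) * len (c1 u) * is_rep u \<le> n"
    using first_start_le[of u i] i by (simp add: first_start_def)
  ultimately show "state (eval_com b D load s) \<sigma> m" "loaded (eval_com b D load s) (u, d, i, j)"
    using assms D[OF u] D[OF children(1)[OF u]] D[OF children(2)[OF u]] b_ge
    by (simp_all add: load_def word_eq state_def loaded_def first_start_def split_pos_def)
qed

lemma eval_push_right:
  assumes "state s \<sigma> m" "loaded s (u, d, i, j)" "valid t (u, d, i, j)" "length \<sigma> \<le> n"
  shows "loaded (eval_com b D push_right s) (u, d, i, j)"
    "state (eval_com b D push_right s)
      ((if split_pos u i < j then [(c2 u, d + split_pos u i, i - split_pos u i,
          min (j - split_pos u i) (len (c2 u)))] else []) @ \<sigma>) m"
proof -
  have u: "u \<in> subs t" and b: "d \<le> n" "i \<le> n" "j \<le> n" "len (c2 u) \<le> n"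
    using assms(3) len_le[of u] len_le[OF children(2)[of u]] by (auto simp: len_t)
  let ?m = "split_pos u i"
  let ?x = "min (j - ?m) (len (c2 u))"
  have "loaded (eval_com b D push_right s) (u, d, i, j) \<and> state (eval_com b D push_right s)
      ((if ?m < j then [(c2 u, d + ?m, i - ?m, ?x)] else []) @ \<sigma>) m"
  proof (cases "?m < j")
    case False
    then have "eval_com b D push_right s = s"
      using assms(2) b b_ge by (simp add: push_right_def loaded_def word_eq)
    then show ?thesis using False assms by simp
  next
    case True
    define s' where "s' = s\<lparr>regs := (regs s)(14 := ?x)\<rparr>"
    have "eval_com b D push_right s =
        eval_com b D (push (Reg 9) (add (Reg 5) (Reg 13)) (sub (Reg 6) (Reg 13)) (Reg 14)) s'"
      using assms(2) True b b_ge by (simp add: push_right_def loaded_def word_eq s'_def min_def)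
    also have "\<dots> = s'\<lparr>regs := (regs s')(2 := 4 * length \<sigma> + 4),
      work := (work s')(4 * length \<sigma> := adr (c2 u), 4 * length \<sigma> + 1 := d + ?m,
        4 * length \<sigma> + 2 := i - ?m, 4 * length \<sigma> + 3 := ?x)\<rparr>"
      using assms True b by (intro eval_push) (auto simp: s'_def loaded_def state_def word_eq)
    finally have e: "eval_com b D push_right s = \<dots>" .
    have "state s' \<sigma> m" using assms(1) by (simp add: s'_def state_def)
    then have "state (eval_com b D push_right s) ((c2 u, d + ?m, i - ?m, ?x) # \<sigma>) m"
      unfolding e by (rule state_push)
    moreover have "loaded (eval_com b D push_right s) (u, d, i, j)"
      unfolding e using assms(2) by (simp add: loaded_def s'_def)
    ultimately show ?thesis using True by simp
  qed
  then show "loaded (eval_com b D push_right s) (u, d, i, j)"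
    "state (eval_com b D push_right s) ((if ?m < j then [(c2 u, d + ?m, i - ?m, ?x)] else []) @ \<sigma>) m"
    by auto
qed

lemma eval_push_left:
  assumes "state s \<sigma> m" "loaded s (u, d, i, j)" "valid t (u, d, i, j)" "length \<sigma> \<le> n + 1"
  shows "state (eval_com b D push_left s)
      ((if i < split_pos u i then [(c1 u, d + first_start u i, i - first_start u i,
          min j (split_pos u i) - first_start u i)] else []) @ \<sigma>) m"
proof -
  have u: "u \<in> subs t" and b: "d \<le> n" "i \<le> n" "j \<le> n"
    using assms(3) len_le[of u] by (auto simp: len_t)
  let ?m = "split_pos u i"
  let ?st = "first_start u i"
  have st: "?st \<le> n" using first_start_le[of u i] b by linarith
  show ?thesis
  proof (cases "i < ?m")
    case False
    then have "eval_com b D push_left s = s"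
      using assms(2) b b_ge by (simp add: push_left_def loaded_def word_eq)
    then show ?thesis using False assms by simp
  next
    case True
    define s' where "s' = s\<lparr>regs := (regs s)(14 := min j ?m)\<rparr>"
    have "eval_com b D push_left s =
        eval_com b D (push (Reg 8) (add (Reg 5) (Reg 12)) (sub (Reg 6) (Reg 12)) (sub (Reg 14) (Reg 12))) s'"
      using assms(2) True b b_ge by (simp add: push_left_def loaded_def word_eq s'_def min_def)
    also have "\<dots> = s'\<lparr>regs := (regs s')(2 := 4 * length \<sigma> + 4),
      work := (work s')(4 * length \<sigma> := adr (c1 u), 4 * length \<sigma> + 1 := d + ?st,
        4 * length \<sigma> + 2 := i - ?st, 4 * length \<sigma> + 3 := min j ?m - ?st)\<rparr>"
      using assms True b st by (intro eval_push) (auto simp: s'_def loaded_def state_def word_eq)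
    finally have e: "eval_com b D push_left s = \<dots>" .
    have "state s' \<sigma> m" using assms(1) by (simp add: s'_def state_def)
    then have "state (eval_com b D push_left s) ((c1 u, d + ?st, i - ?st, min j ?m - ?st) # \<sigma>) m"
      unfolding e by (rule state_push)
    then show ?thesis using True by simp
  qed
qed

lemma eval_body:
  assumes "state s (it # \<sigma>) m" "fits (it # \<sigma>)"
  shows "state (eval_com b D body s) ((if full it then [] else expand it) @ \<sigma>)
     (if full it then min m (item_key it) else m)"
proof -
  obtain u d i j where it: "it = (u, d, i, j)" by (cases it)
  have v: "valid t (u, d, i, j)" and l: "length \<sigma> \<le> n" using assms(2) by (auto simp: it)
  then have u: "u \<in> subs t" and b: "i < j" "j \<le> len u" "d + len u \<le> n" "len u \<le> n"
    using len_le by (auto simp: len_t)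
  define s1 where "s1 = eval_com b D pop s"
  note s1 = eval_pop[OF assms(1)[unfolded it] l, folded s1_def]
  have cond: "expr_val b D s1 (Op Equal (sub (Reg 7) (Reg 6)) (Index (Reg 4))) \<noteq> 0 \<longleftrightarrow> full it"
    using s1 D[OF u] b b_ge by (simp add: it word_eq)
  show ?thesis
  proof (cases "full it")
    case True
    then have "i = 0" "j = len u" using b by (auto simp: it)
    moreover have "eval_com b D body s = eval_com b D update s1"
      unfolding body_def eval_com.simps s1_def[symmetric] using cond True by simp
    ultimately show ?thesis
      using eval_update[OF s1(1-3) u b(3)] True by (simp add: it)
  next
    case False
    define s2 where "s2 = eval_com b D load s1"
    define s3 where "s3 = eval_com b D push_right s2"
    have e: "eval_com b D body s = eval_com b D push_left s3"
      unfolding body_def eval_com.simps s1_def[symmetric] s2_def[symmetric] s3_def[symmetric]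
      using cond False by simp
    note s2 = eval_load[OF s1 v, folded s2_def]
    note s3 = eval_push_right[OF s2 v l, folded s3_def]
    show ?thesis
      unfolding e using eval_push_left[OF s3(2,1) v] False l by (simp add: it Let_def)
  qed
qed

section \<open>Invariants and running time of the loop\<close>

lemma fits_step:
  assumes "fits (it # \<sigma>)" "\<not> full it"
  shows "fits (expand it @ \<sigma>)"
proof -
  have *: "valid t x \<and> item_height x < item_height it" if "x \<in> set (expand it)" for x
    using expand_valid[OF _ wf assms(2) that] assms(1) by simp
  have "length (expand it) \<le> 2" by (rule length_expand)
  then consider "expand it = []" | x where "expand it = [x]" | x y where "expand it = [x, y]"
    by (cases "expand it"; cases "tl (expand it)"; cases "tl (tl (expand it))") auto
  then show ?thesis
    by cases (use assms(1) * in \<open>force+\<close>)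
qed

definition total :: "'a item list \<Rightarrow> nat \<Rightarrow> nat" where
  "total \<sigma> m = foldr (\<lambda>it. min (item_key it)) \<sigma> m"

lemma total_min: "total \<sigma> (min m x) = min x (total \<sigma> m)"
  by (induction \<sigma>) (auto simp: total_def min.left_commute min.commute)

lemma total_step:
  assumes "valid t it" "\<not> full it"
  shows "total (expand it @ \<sigma>) m = total (it # \<sigma>) m"
proof -
  have e: "expand it \<noteq> []" "item_key it = Min (item_key ` set (expand it))"
    using item_key_expand[OF assms(1) wf assms(2)] by auto
  have "length (expand it) \<le> 2" by (rule length_expand)
  with e(1) consider x where "expand it = [x]" | x y where "expand it = [x, y]"
    by (cases "expand it"; cases "tl (expand it)"; cases "tl (tl (expand it))") auto
  then show ?thesis by cases (use e(2) in \<open>auto simp: total_def min.assoc\<close>)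
qed

text \<open>Each iteration lowers the summed potential and preserves \<open>total\<close>, the
  minimum of the accumulator and all pending keys. The summands 2 are the cost of a loop test,
  successful or final.\<close>

lemma exec_loop:
  assumes "state s \<sigma> m" "fits \<sigma>" "(\<Sum>x\<leftarrow>\<sigma>. pot x) \<le> p"
  shows "\<exists>T s'. T \<le> (com_cost body + 2) * p + 2 \<and> exec b D (While (Reg 2) body) s T s' \<and>
     regs s' 3 = total \<sigma> m"
  using assms
proof (induction p arbitrary: s \<sigma> m)
  case 0
  have "\<sigma> = []"
  proof (cases \<sigma>)
    case (Cons it \<tau>)
    then show ?thesis using 0 by (cases it) (auto split: if_splits)
  qed
  then have "expr_val b D s (Reg 2) = 0" "regs s 3 = m" using 0 by (simp_all add: state_def)
  then have "exec b D (While (Reg 2) body) s (1 + expr_cost (Reg 2)) s" by (intro exec.WhileFalse)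
  then show ?case using \<open>\<sigma> = []\<close> \<open>regs s 3 = m\<close> by (intro exI[of _ "Suc (Suc 0)"] exI[of _ s]) (simp add: total_def)
next
  case (Suc p)
  show ?case
  proof (cases \<sigma>)
    case Nil
    then have "expr_val b D s (Reg 2) = 0" "regs s 3 = m" using Suc by (simp_all add: state_def)
    then have "exec b D (While (Reg 2) body) s (1 + expr_cost (Reg 2)) s" by (intro exec.WhileFalse)
    then show ?thesis using Nil \<open>regs s 3 = m\<close> by (intro exI[of _ "Suc (Suc 0)"] exI[of _ s]) (simp add: total_def)
  next
    case (Cons it \<tau>)
    let ?\<sigma>' = "(if full it then [] else expand it) @ \<tau>"
    let ?m' = "if full it then min m (item_key it) else m"
    let ?s' = "eval_com b D body s"
    have v: "valid t it" using Suc Cons by simp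
    have st: "state ?s' ?\<sigma>' ?m'" using eval_body Suc Cons by blast
    have "fits ?\<sigma>'" using fits_step[of it \<tau>] Suc Cons by auto
    moreover have "(\<Sum>x\<leftarrow>?\<sigma>'. pot x) \<le> p"
    proof (cases "full it")
      case True
      then have "pot it = 1" by (cases it) auto
      with True Suc(4) Cons show ?thesis by simp
    next
      case False
      with expand_pot[OF v wf] Suc(4) Cons show ?thesis by fastforce
    qed
    ultimately obtain T s' where T: "T \<le> (com_cost body + 2) * p + 2"
      "exec b D (While (Reg 2) body) ?s' T s'" "regs s' 3 = total ?\<sigma>' ?m'"
      using Suc.IH st by blast
    have tot: "total ?\<sigma>' ?m' = total \<sigma> m"
      using total_step[OF v] Cons total_min[of \<tau> m "item_key it"] by (simp add: total_def)
    obtain T1 where T1: "T1 \<le> com_cost body" "exec b D body s T1 ?s'"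
      using exec_loop_free[OF loop_free_body] by blast
    have "expr_val b D s (Reg 2) \<noteq> 0" using Suc Cons by (simp add: state_def)
    from exec.WhileTrue[OF this T1(2) T(2)]
    have "exec b D (While (Reg 2) body) s (2 + T1 + T) s'" by simp
    moreover have "2 + T1 + T \<le> (com_cost body + 2) * Suc p + 2" using T1 T by simp
    ultimately show ?thesis using T(3) tot by metis
  qed
qed

lemma exec_rmq_prog:
  assumes "1 \<le> i" "i \<le> j" "j \<le> n"
  shows "\<exists>T. T \<le> (com_cost body + 2) * (4 * height t + 1) + (com_cost init + com_cost finish + 2) \<and>
     answers b D rmq_prog i j T (min_key (yield t) (i - 1) j mod n + 1)"
proof -
  let ?it = "(t, 0, i - 1, j)"
  let ?s0 = "query_mem i j"
  let ?s1 = "eval_com b D init ?s0"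
  have n: "n > 0" using assms by simp
  have "state ?s1 [?it] (n * n)"
  proof -
    have s0: "state ?s0 [] 0" by (simp add: state_def query_mem_def)
    have "eval_com b D (push (Const 1) (Const 0) (sub (Reg 0) (Const 1)) (Reg 1)) ?s0 =
      ?s0\<lparr>regs := (regs ?s0)(2 := 4 * 0 + 4), work := (work ?s0)(4 * 0 := 1, 4 * 0 + 1 := 0,
        4 * 0 + 2 := i - 1, 4 * 0 + 3 := j)\<rparr>"
      using assms b_ge by (intro eval_push) (auto simp: query_mem_def word_eq)
    moreover have "state (?s0\<lparr>regs := (regs ?s0)(2 := 4 * 0 + 4), work := (work ?s0)(4 * 0 := 1, 4 * 0 + 1 := 0,
        4 * 0 + 2 := i - 1, 4 * 0 + 3 := j)\<rparr>) [?it] 0"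
      using state_push[OF s0, of t] by (simp add: D0)
    ultimately show ?thesis using D0 by (simp add: init_def state_def word_eq)
  qed
  moreover have "fits [?it]" using assms height_le_len[OF wf] by (auto simp: subs_self len_t)
  moreover have "(\<Sum>x\<leftarrow>[?it]. pot x) \<le> 4 * height t + 1" using pot_le(3)[of t 0 "i - 1" j] by simp
  ultimately obtain T s' where T: "T \<le> (com_cost body + 2) * (4 * height t + 1) + 2"
    "exec b D (While (Reg 2) body) ?s1 T s'" "regs s' 3 = total [?it] (n * n)"
    using exec_loop by blast
  have "min_key (yield t) (i - 1) j < n * n"
  proof -
    have "min_key (yield t) (i - 1) j \<le> key (yield t) (i - 1)"
      unfolding min_key_def using assms by (intro Min_le) auto
    moreover have "rk (yield t ! (i - 1)) < n" using rk assms len_t length_yield[of t] by simp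
    then have "Suc (rk (yield t ! (i - 1))) * n \<le> n * n" by (intro mult_le_mono1) simp
    then have "key (yield t) (i - 1) < n * n" using assms by (simp add: key_def)
    ultimately show ?thesis by linarith
  qed
  then have r3: "regs s' 3 = min_key (yield t) (i - 1) j" "regs s' 3 < n * n"
    using T(3) by (simp_all add: total_def)
  have "regs s' 3 mod n < n" using n by simp
  then have fin: "regs (eval_com b D finish s') 0 = min_key (yield t) (i - 1) j mod n + 1"
    using r3 D0 b_ge by (simp add: finish_def word_eq)
  obtain T1 where T1: "T1 \<le> com_cost init" "exec b D init ?s0 T1 ?s1"
    using exec_loop_free[of init b D ?s0] by (auto simp: init_def push_def)
  obtain T2 where T2: "T2 \<le> com_cost finish" "exec b D finish s' T2 (eval_com b D finish s')"
    using exec_loop_free[of finish b D s'] by (auto simp: finish_def)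
  have "exec b D rmq_prog ?s0 (T1 + (T + T2)) (eval_com b D finish s')"
    unfolding rmq_prog_def by (rule exec.Seq[OF T1(2) exec.Seq[OF T(2) T2(2)]])
  moreover have "T1 + (T + T2) \<le> (com_cost body + 2) * (4 * height t + 1) + (com_cost init + com_cost finish + 2)"
    using T1(1) T2(1) T(1) by linarith
  ultimately show ?thesis unfolding answers_def using fin by blast
qed

end

section \<open>The index\<close>

text \<open>Symbols of an arbitrary linear order need not fit into words; ranks within
  \<open>w\<close> are below \<open>length w\<close> and compare in the same way.\<close>

definition sym_rank :: "'a::linorder list \<Rightarrow> 'a \<Rightarrow> nat" where
  "sym_rank w a = card {x \<in> set w. x < a}"

lemma sym_rank_less: "a \<in> set w \<Longrightarrow> sym_rank w a < length w"
proof -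
  assume "a \<in> set w"
  then have "{x \<in> set w. x < a} \<subset> set w" by auto
  then have "card {x \<in> set w. x < a} < card (set w)" by (intro psubset_card_mono) auto
  then show ?thesis using card_length[of w] by (simp add: sym_rank_def)
qed

lemma sym_rank_mono: "a \<in> set w \<Longrightarrow> a < c \<Longrightarrow> sym_rank w a < sym_rank w c"
  unfolding sym_rank_def by (intro psubset_card_mono) auto

lemma rmq_eq:
  fixes w :: "'a::linorder list"
  assumes ij: "1 \<le> i" "i \<le> j" "j \<le> length w"
  shows "rmq w i j = keys.min_key (sym_rank w) (length w) w (i - 1) j mod length w + 1"
proof -
  interpret keys "sym_rank w" "length w" .
  let ?n = "length w"
  have "min_key w (i - 1) j \<in> key w ` {i - 1..<j}"
    unfolding min_key_def using ij by (intro Min_in) auto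
  then obtain q where q: "i - 1 \<le> q" "q < j" "min_key w (i - 1) j = key w q" by auto
  have min: "key w q \<le> key w p" if "i - 1 \<le> p" "p < j" for p
    unfolding q(3)[symmetric] min_key_def using that by (intro Min_le) auto
  have le: "w ! q \<le> w ! p" if p: "i - 1 \<le> p" "p < j" for p
  proof (rule ccontr)
    assume "\<not> w ! q \<le> w ! p"
    then have "sym_rank w (w ! p) < sym_rank w (w ! q)"
      using p ij by (intro sym_rank_mono) auto
    \<comment> \<open>One unit of rank outweighs any difference of positions, as these are below
      \<open>?n\<close>.\<close>
    then have "Suc (sym_rank w (w ! p)) * ?n \<le> sym_rank w (w ! q) * ?n" by (intro mult_le_mono1) simp
    then have "key w p < key w q" using p ij by (simp add: key_def)
    with min[OF p] show False by simp
  qed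
  have Min: "Min ((\<lambda>q. w ! (q - 1)) ` {i..j}) = w ! q"
  proof (rule Min_eqI)
    show "w ! q \<in> (\<lambda>q. w ! (q - 1)) ` {i..j}" using q ij by (intro image_eqI[of _ _ "q + 1"]) auto
    fix y assume "y \<in> (\<lambda>q. w ! (q - 1)) ` {i..j}"
    then show "w ! q \<le> y" using le ij by auto
  qed simp
  have "rmq w i j = q + 1"
    unfolding rmq_def Min
  proof (rule Least_equality)
    fix p assume p: "i \<le> p \<and> p \<le> j \<and> w ! (p - 1) = w ! q"
    then have "key w q \<le> key w (p - 1)" using ij by (intro min) auto
    then show "q + 1 \<le> p" using p ij by (cases p) (auto simp: key_def)
  qed (use q ij in auto)
  moreover have "key w q mod ?n = q" using q ij by (simp add: key_def)
  ultimately show ?thesis using q(3) by simp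
qed

lemma nth_concat_map:
  assumes "\<And>x. length (f x) = m" "i < length xs" "k < m"
  shows "concat (map f xs) ! (m * i + k) = f (xs ! i) ! k"
  using assms(2)
proof (induction xs arbitrary: i)
  case (Cons x xs)
  show ?case
  proof (cases i)
    case (Suc i')
    then have "m * i + k = length (f x) + (m * i' + k)" using assms(1) by simp
    moreover have "concat (map f xs) ! (m * i' + k) = f (xs ! i') ! k" using Cons Suc by simp
    ultimately show ?thesis using Suc by (simp add: nth_append)
  qed (use assms in \<open>simp add: nth_append\<close>)
qed simp

lemma length_concat_map: "(\<And>x. length (f x) = m) \<Longrightarrow> length (concat (map f xs)) = m * length xs"
  by (induction xs) auto

definition node_words :: "('a tr \<Rightarrow> nat) \<Rightarrow> ('a tr \<Rightarrow> nat) \<Rightarrow> 'a tr \<Rightarrow> nat list" where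
  "node_words adr v u = [len u, v u, adr (c1 u), adr (c2 u), is_rep u]"

text \<open>Listing the root first gives it the address 1, which the program can contain as a
  constant independent of the string.\<close>

lemma layout_exists:
  fixes t :: "'a tr" and v :: "'a tr \<Rightarrow> nat"
  shows "\<exists>D adr. length D = 1 + 5 * card (subs t) \<and> D \<noteq> [] \<and> D ! 0 = n \<and> adr t = 1 \<and>
     (\<forall>u\<in>subs t. adr u + 4 < length D \<and> D ! adr u = len u \<and> D ! (adr u + 1) = v u \<and>
        D ! (adr u + 2) = adr (c1 u) \<and> D ! (adr u + 3) = adr (c2 u) \<and> D ! (adr u + 4) = is_rep u) \<and>
     set D \<subseteq> insert n (\<Union>u\<in>subs t. {len u, v u, adr (c1 u), adr (c2 u), is_rep u})"
proof -
  obtain ys where ys: "set ys = subs t - {t}" "distinct ys"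
    using finite_distinct_list[of "subs t - {t}"] finite_subs by blast
  define xs where "xs = t # ys"
  have xs: "set xs = subs t" "distinct xs" using ys subs_self[of t] by (auto simp: xs_def)
  then have lxs: "length xs = card (subs t)" using distinct_card by metis
  define ix where "ix u = (SOME i. i < length xs \<and> xs ! i = u)" for u
  have ix: "ix u < length xs \<and> xs ! ix u = u" if "u \<in> subs t" for u
    unfolding ix_def by (rule someI_ex) (use that xs in \<open>metis in_set_conv_nth\<close>)
  have "ix t = 0"
    using ix[OF subs_self] xs(2) by (metis nth_Cons_0 nth_eq_iff_index_eq xs_def length_pos_if_in_set
        list.set_intros(1))
  define adr where "adr u = 1 + 5 * ix u" for u
  define D where "D = n # concat (map (node_words adr v) xs)"
  have len: "length (node_words adr v u) = 5" for u by (simp add: node_words_def)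
  have lD: "length D = 1 + 5 * card (subs t)"
    using length_concat_map[of "node_words adr v" 5 xs, OF len] lxs by (simp add: D_def)
  have nth: "D ! (adr u + k) = node_words adr v u ! k" if "u \<in> subs t" "k < 5" for u k
  proof -
    have "D ! (adr u + k) = concat (map (node_words adr v) xs) ! (5 * ix u + k)"
      by (simp add: D_def adr_def)
    also have "\<dots> = node_words adr v u ! k" using nth_concat_map[of "node_words adr v" 5, OF len] ix that by simp
    finally show ?thesis .
  qed
  have "adr u + 4 < length D" if "u \<in> subs t" for u
    using ix[OF that] lD lxs by (simp add: adr_def)
  moreover have "adr t = 1" using \<open>ix t = 0\<close> by (simp add: adr_def)
  moreover have "D \<noteq> []" "D ! 0 = n" by (simp_all add: D_def)
  moreover have "set D \<subseteq> insert n (\<Union>u\<in>subs t. {len u, v u, adr (c1 u), adr (c2 u), is_rep u})"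
    using xs(1) by (auto simp: D_def node_words_def)
  moreover have "D ! adr u = len u \<and> D ! (adr u + 1) = v u \<and>
        D ! (adr u + 2) = adr (c1 u) \<and> D ! (adr u + 3) = adr (c2 u) \<and> D ! (adr u + 4) = is_rep u"
    if "u \<in> subs t" for u
    using nth[OF that, of 0] nth[OF that, of 1] nth[OF that, of 2] nth[OF that, of 3] nth[OF that, of 4]
    by (simp add: node_words_def numeral_eq_Suc)
  ultimately show ?thesis using lD by blast
qed

text \<open>Twice the logarithm accommodates keys up to \<open>n * n\<close>; the 10 further bits
  give a factor 1024 that absorbs rounding and lower-order terms for every \<open>n\<close>.\<close>

definition word_len :: "nat \<Rightarrow> nat" where
  "word_len n = 2 * floor_log n + 10"

lemma word_len_bound: "n * n + 20 * n + 101 < 2 ^ word_len n"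
proof -
  define p :: nat where "p = 2 ^ floor_log n"
  have "n \<le> 2 * p" using floor_log_exp2_ge[of n] by (simp add: p_def)
  then have "n * n \<le> (2 * p) * (2 * p)" by (intro mult_le_mono)
  moreover have "1 \<le> p" by (simp add: p_def)
  then have "p * 1 \<le> p * p" by (intro mult_le_mono2)
  moreover have "2 ^ word_len n = 1024 * (p * p)"
    by (simp add: word_len_def p_def power_add power_mult power2_eq_square power_mult_distrib)
      (simp add: power_mult_distrib[symmetric])
  ultimately show ?thesis using \<open>n \<le> 2 * p\<close> \<open>1 \<le> p\<close> by linarith
qed

lemma word_len_bigtheta: "(\<lambda>n. real (word_len n)) \<in> \<Theta>(\<lambda>n. ln (real n))"
proof (rule bigthetaI)
  have *: "real (floor_log n) \<le> log 2 (real n) \<and> log 2 (real n) < real (floor_log n) + 1" if "n \<ge> 1" for n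
    using floor_log_log[of n] that by simp
  have "(\<lambda>n. real (word_len n)) \<in> O(\<lambda>n. 2 * log 2 (real n) + 10)"
  proof (rule landau_o.big_mono)
    show "\<forall>\<^sub>F n in sequentially. norm (real (word_len n)) \<le> norm (2 * log 2 (real n) + 10)"
      using eventually_ge_at_top[of 1] by eventually_elim (use * in \<open>force simp: word_len_def\<close>)
  qed
  also have "(\<lambda>n. 2 * log 2 (real n) + 10) \<in> O(\<lambda>n::nat. ln (real n))" by real_asymp
  finally show "(\<lambda>n. real (word_len n)) \<in> O(\<lambda>n. ln (real n))" .
  have "(\<lambda>n::nat. ln (real n)) \<in> O(\<lambda>n. 2 * log 2 (real n))" by real_asymp
  also have "(\<lambda>n. 2 * log 2 (real n)) \<in> O(\<lambda>n. real (word_len n))"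
  proof (rule landau_o.big_mono)
    show "\<forall>\<^sub>F n in sequentially. norm (2 * log 2 (real n)) \<le> norm (real (word_len n))"
      using eventually_ge_at_top[of 1]
    proof eventually_elim
      case (elim n)
      then have "log 2 (real n) \<ge> 0" by simp
      with *[OF elim] show ?case by (simp add: word_len_def)
    qed
  qed
  finally show "(\<lambda>n. real (word_len n)) \<in> \<Omega>(\<lambda>n. ln (real n))" by (simp add: bigomega_iff_bigo)
qed

lemma index_exists:
  fixes w :: "'a::linorder list"
  assumes "w \<noteq> []"
  shows "\<exists>D. length D \<le> 54 * g_rl w \<and> (\<forall>x\<in>set D. x < 2 ^ word_len (length w)) \<and>
     (\<forall>i j. 1 \<le> i \<and> i \<le> j \<and> j \<le> length w \<longrightarrow>
        (\<exists>T. real T \<le> (com_cost body + 2) * (4 * (30 * log 2 (length w) + 13) + 1) +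
             (com_cost init + com_cost finish + 2) \<and>
           answers (word_len (length w)) D rmq_prog i j T (rmq w i j)))"
proof -
  let ?n = "length w"
  obtain t where t: "yield t = w" "wft t" "card (subs t) \<le> 9 * g_rl w"
    "real (height t) \<le> 30 * log 2 ?n + 13"
    using balanced_tree_exists[OF assms] by blast
  have len: "len t = ?n" using t length_yield by metis
  interpret keys "sym_rank w" ?n .
  obtain D adr where lay: "length D = 1 + 5 * card (subs t)" "D \<noteq> []" "D ! 0 = ?n" "adr t = 1"
    "\<And>u. u \<in> subs t \<Longrightarrow> adr u + 4 < length D \<and> D ! adr u = len u \<and> D ! (adr u + 1) = min_key (yield u) 0 (len u) \<and>
        D ! (adr u + 2) = adr (c1 u) \<and> D ! (adr u + 3) = adr (c2 u) \<and> D ! (adr u + 4) = is_rep u"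
    "set D \<subseteq> insert ?n (\<Union>u\<in>subs t. {len u, min_key (yield u) 0 (len u), adr (c1 u), adr (c2 u), is_rep u})"
    using layout_exists[of t ?n "\<lambda>u. min_key (yield u) 0 (len u)"] by blast
  have word: "length D + ?n * ?n + 10 * ?n + 100 < 2 ^ word_len ?n"
    using word_len_bound[of ?n] card_subs_le[OF t(2)] lay(1) len by linarith
  interpret machine "sym_rank w" ?n "word_len ?n" D t adr
    by standard (use t len sym_rank_less lay word in auto)
  have "card (subs t) > 0" using finite_subs subs_self card_gt_0_iff by blast
  \<comment> \<open>\<open>1 + 5 * card (subs t)\<close> is at most
    \<open>6 * card (subs t)\<close>, and \<open>6 * 9 = 54\<close>.\<close>
  then have "length D \<le> 54 * g_rl w" using t(3) lay(1) by linarith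
  moreover have "\<forall>x\<in>set D. x < 2 ^ word_len ?n"
  proof
    fix x assume "x \<in> set D"
    then consider "x = ?n" | u where "u \<in> subs t"
      "x \<in> {len u, min_key (yield u) 0 (len u), adr (c1 u), adr (c2 u), is_rep u}" using lay(6) by blast
    then have "x \<le> length D + ?n * ?n + 10 * ?n + 100"
    proof cases
      case (2 u)
      have "is_rep u \<le> 1" by (cases u) auto
      with 2 len_le[OF 2(1)] min_key_le[OF 2(1)] lay(5)[OF children(1)[OF 2(1)]] lay(5)[OF children(2)[OF 2(1)]]
      show ?thesis by auto
    qed simp
    with word show "x < 2 ^ word_len ?n" by linarith
  qed
  moreover have "\<exists>T. real T \<le> (com_cost body + 2) * (4 * (30 * log 2 ?n + 13) + 1) +
             (com_cost init + com_cost finish + 2) \<and>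
           answers (word_len ?n) D rmq_prog i j T (rmq w i j)"
    if ij: "1 \<le> i" "i \<le> j" "j \<le> ?n" for i j
  proof -
    obtain T where T: "T \<le> (com_cost body + 2) * (4 * height t + 1) + (com_cost init + com_cost finish + 2)"
      "answers (word_len ?n) D rmq_prog i j T (min_key (yield t) (i - 1) j mod ?n + 1)"
      using exec_rmq_prog[OF ij] by blast
    have "real T \<le> real ((com_cost body + 2) * (4 * height t + 1) + (com_cost init + com_cost finish + 2))"
      using T(1) by (simp only: of_nat_le_iff)
    also have "\<dots> = (com_cost body + 2) * (4 * real (height t) + 1) + (com_cost init + com_cost finish + 2)"
      by (simp add: algebra_simps)
    also have "\<dots> \<le> (com_cost body + 2) * (4 * (30 * log 2 ?n + 13) + 1) + (com_cost init + com_cost finish + 2)"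
      using t(4) by (intro add_mono mult_left_mono) auto
    finally show ?thesis using T(2) rmq_eq[OF ij] t(1) by auto
  qed
  ultimately show ?thesis by blast
qed

theorem theorem3:
  "\<exists>(P :: com) (b :: nat \<Rightarrow> nat) (T :: nat \<Rightarrow> real) (C :: real).
     (\<lambda>n. real (b n)) \<in> \<Theta>(\<lambda>n. ln (real n)) \<and>
     (\<forall>n. n < 2 ^ b n) \<and>
     T \<in> O(\<lambda>n. ln (real n)) \<and>
     (\<forall>w :: 'a::linorder list. w \<noteq> [] \<longrightarrow>
        (\<exists>D :: nat list.
           real (length D) \<le> C * real (g_rl w) \<and>
           (\<forall>x \<in> set D. x < 2 ^ b (length w)) \<and>
           (\<forall>i j. 1 \<le> i \<and> i \<le> j \<and> j \<le> length w \<longrightarrow>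
              (\<exists>t. real t \<le> T (length w) \<and>
                   answers (b (length w)) D P i j t (rmq w i j)))))"
proof -
  define T where "T n = real (com_cost body + 2) * (4 * (30 * log 2 (real n) + 13) + 1) +
             real (com_cost init + com_cost finish + 2)" for n :: nat
  have "(\<lambda>n::nat. 4 * (30 * log 2 (real n) + 13) + 1) \<in> O(\<lambda>n. ln (real n))" by real_asymp
  moreover have "(\<lambda>n::nat. real (com_cost init + com_cost finish + 2)) \<in> O(\<lambda>n. 1)"
    by (rule bigoI[of _ "real (com_cost init + com_cost finish + 2)"]) simp
  then have "(\<lambda>n::nat. real (com_cost init + com_cost finish + 2)) \<in> O(\<lambda>n. ln (real n))"
    by (rule landau_o.big.trans) real_asymp
  ultimately have "T \<in> O(\<lambda>n. ln (real n))"
    unfolding T_def by (intro sum_in_bigo) simp_all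
  moreover have "n < 2 ^ word_len n" for n using word_len_bound[of n] by linarith
  moreover have "\<exists>D. real (length D) \<le> 54 * real (g_rl w) \<and> (\<forall>x\<in>set D. x < 2 ^ word_len (length w)) \<and>
     (\<forall>i j. 1 \<le> i \<and> i \<le> j \<and> j \<le> length w \<longrightarrow> (\<exists>t. real t \<le> T (length w) \<and>
           answers (word_len (length w)) D rmq_prog i j t (rmq w i j)))"
    if w: "w \<noteq> []" for w :: "'a list"
  proof -
    from index_exists[OF w] obtain D where D: "length D \<le> 54 * g_rl w"
      "\<forall>x\<in>set D. x < 2 ^ word_len (length w)"
      "\<forall>i j. 1 \<le> i \<and> i \<le> j \<and> j \<le> length w \<longrightarrow> (\<exists>t. real t \<le> T (length w) \<and>
           answers (word_len (length w)) D rmq_prog i j t (rmq w i j))"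
      unfolding T_def by blast
    have "real (length D) \<le> real (54 * g_rl w)" using D(1) by (simp only: of_nat_le_iff)
    with D show ?thesis by (intro exI[of _ D]) simp
  qed
  ultimately show ?thesis using word_len_bigtheta by blast
qed

end
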